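(* Let $\nu=(\nu_0,\dots,\nu_n)$ be a lattice path. For any two increment vectors $\delta,\delta'$ with respect to $\nu$ and every integer $\ell\ge 0$, the alt $\nu$-Tamari lattices $\operatorname{Tam}_{\nu}(\delta)$ and $\operatorname{Tam}_{\nu}(\delta')$ have the same number of linear intervals of length $\ell$.
   Context: Lattice paths: a path from $(0,0)$ to $(m,n)$ with unit north steps $N$ and east steps $E$ is encoded by $\nu=(\nu_0,\dots,\nu_n)$ with $\nu_i\ge 0$ integers, where $n$ is the number of north steps, $\nu_0$ is the number of initial east steps, and $\nu_i$ ($i\ge1$) is the number of consecutive east steps immediately following the $i$-th north step; $m=\nu_0+\dots+\nu_n$. A $\nu$-path is a lattice path $\mu$ with north and east unit steps, with the same endpoints as $\nu$, lying weakly above $\nu$; equivalently $\mu=(\mu_0,\dots,\mu_n)$ with $\mu_i\ge0$ and $\sum_{i=0}^j\mu_i\le\sum_{i=0}^j\nu_i$ for all $0\le j\le n$, with equality for $j=n$. An increment vector with respect to $\nu$ is $\delta=(\delta_1,\dots,\delta_n)\in\mathbb{N}^n$ with $0\le\delta_i\le\nu_i$ for all $1\le i\le n$. The $\delta$-altitude of the lattice points of a $\nu$-path $\mu$ is defined as follows: the initial point has $\delta$-altitude $0$, the $i$-th north step of $\mu$ increases the $\delta$-altitude by $\delta_i$, and each east step decreases it by $1$. Given a valley $EN$ of $\mu$ (an east step immediately followed by a north step), let $p$ be the lattice point between these two steps, let $q$ be the next lattice point of $\mu$ after $p$ with the same $\delta$-altitude as $p$, and let $\mu_{[p,q]}$ be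 the subpath of $\mu$ from $p$ to $q$. The $\delta$-rotation of $\mu$ at $p$ is the path $\mu'$ obtained from $\mu$ by switching $\mu_{[p,q]}$ with the east step $E$ that precedes it; write $\mu\lessdot_\delta\mu'$. The alt $\nu$-Tamari poset $\operatorname{Tam}_\nu(\delta)$ (which is a lattice) is the reflexive transitive closure of $\delta$-rotations on the set of $\nu$-paths. An interval $[P,Q]$ of a poset is linear if it is totally ordered, i.e. a chain $P=P_0<P_1<\dots<P_\ell=Q$; its length is $\ell$. *)

theory Defs
  imports Main
begin

(* A path nu = (nu_0, ..., nu_n) is the list [nu_0, ..., nu_n]; it is never empty and has
   length n + 1, where n is the number of north steps. *)

datatype step = North | East

definition path_word :: "nat list \<Rightarrow> step list" where
  "path_word \<mu> =
     replicate (hd \<mu>) East @ concat (map (\<lambda>k. North # replicate k East) (tl \<mu>))"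

definition nu_paths :: "nat list \<Rightarrow> nat list set" where
  "nu_paths \<nu> = {\<mu>. length \<mu> = length \<nu> \<and>
     (\<forall>j < length \<nu>. (\<Sum>i\<le>j. \<mu> ! i) \<le> (\<Sum>i\<le>j. \<nu> ! i)) \<and>
     sum_list \<mu> = sum_list \<nu>}"

(* delta = (delta_1, ..., delta_n) is a list indexed from 0, so delta_i is \<delta> ! (i - 1). *)
definition increment_vector :: "nat list \<Rightarrow> nat list \<Rightarrow> bool" where
  "increment_vector \<nu> \<delta> \<longleftrightarrow>
     length \<nu> = Suc (length \<delta>) \<and> (\<forall>i < length \<delta>. \<delta> ! i \<le> \<nu> ! Suc i)"

(* Altitude of the lattice point reached after the first k steps of w. *)
definition altitude :: "nat list \<Rightarrow> step list \<Rightarrow> nat \<Rightarrow> int" where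
  "altitude \<delta> w k =
     int (\<Sum>i < count_list (take k w) North. \<delta> ! i) - int (count_list (take k w) East)"

(* In the word A E B C of \<mu>, the point p of the valley comes after A E, and B is the subpath
   from p to q.  The points strictly between them all differ in altitude from p. *)
definition rotation :: "nat list \<Rightarrow> nat list \<Rightarrow> nat list \<Rightarrow> bool" where
  "rotation \<delta> \<mu> \<mu>' \<longleftrightarrow> (\<exists>A B C p q.
     path_word \<mu> = A @ [East] @ B @ C \<and>
     path_word \<mu>' = A @ B @ [East] @ C \<and>
     B \<noteq> [] \<and> hd B = North \<and>
     p = length (A @ [East]) \<and> q = length (A @ [East] @ B) \<and>
     altitude \<delta> (path_word \<mu>) q = altitude \<delta> (path_word \<mu>) p \<and>
     (\<forall>k. p < k \<and> k < q \<longrightarrow> altitude \<delta> (path_word \<mu>) k \<noteq> altitude \<delta> (path_word \<mu>) p))"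

definition rotation_rel :: "nat list \<Rightarrow> nat list \<Rightarrow> nat list rel" where
  "rotation_rel \<nu> \<delta> = {(\<mu>, \<mu>'). \<mu> \<in> nu_paths \<nu> \<and> \<mu>' \<in> nu_paths \<nu> \<and> rotation \<delta> \<mu> \<mu>'}"

(* The order relation of Tam_nu(delta): pairs (P, Q) with P \<le> Q.  The restriction removes the
   reflexive pairs outside the carrier. *)
definition alt_tamari :: "nat list \<Rightarrow> nat list \<Rightarrow> nat list rel" where
  "alt_tamari \<nu> \<delta> = Restr ((rotation_rel \<nu> \<delta>)\<^sup>*) (nu_paths \<nu>)"

definition interval :: "'a rel \<Rightarrow> 'a \<Rightarrow> 'a \<Rightarrow> 'a set" where
  "interval r P Q = {R. (P, R) \<in> r \<and> (R, Q) \<in> r}"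

(* A finite chain P = P_0 < ... < P_l = Q has l + 1 elements.  Intervals are counted by their
   pairs of end points. *)
definition linear_intervals :: "'a rel \<Rightarrow> nat \<Rightarrow> ('a \<times> 'a) set" where
  "linear_intervals r l = {(P, Q). (P, Q) \<in> r \<and>
     linear_order_on (interval r P Q) (Restr r (interval r P Q)) \<and>
     card (interval r P Q) = l + 1}"

(* Finiteness makes the use of card for counting intervals meaningful. *)
lemma finite_nu_paths: "finite (nu_paths \<nu>)"
proof (rule finite_subset)
  show "nu_paths \<nu> \<subseteq> {\<mu>. set \<mu> \<subseteq> {..sum_list \<nu>} \<and> length \<mu> = length \<nu>}"
    by (auto simp: nu_paths_def dest: member_le_sum_list)
  show "finite {\<mu>. set \<mu> \<subseteq> {..sum_list \<nu>} \<and> length \<mu> = length \<nu>}"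
    by (rule finite_lists_length_eq) simp
qed

lemma finite_linear_intervals: "finite (linear_intervals (alt_tamari \<nu> \<delta>) l)"
proof (rule finite_subset)
  show "linear_intervals (alt_tamari \<nu> \<delta>) l \<subseteq> nu_paths \<nu> \<times> nu_paths \<nu>"
    by (auto simp: linear_intervals_def alt_tamari_def)
qed (simp add: finite_nu_paths)

end

theory Submission
  imports Defs
begin

text \<open>
  Number the north steps of a path from 0 and let \<open>f t\<close> be the number of east steps before north
  step \<open>t\<close>. Paths become weakly increasing integer sequences bounded by the sequence \<open>c\<close> of \<open>\<nu>\<close>, and
  with \<open>s t = \<delta>\<^sub>1 + \<dots> + \<delta>\<^sub>t\<close> the altitude in front of north step \<open>t\<close> is \<open>s t - f t\<close>. A rotation lowers by
  one the entries of the north steps in one excursion, the excursion of \<open>j\<close> being the maximal block of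
  indices \<open>j, j + 1, \<dots>\<close> whose altitudes, after the first, exceed the altitude at \<open>j\<close>.

  The order has a closed description: \<open>f \<le> h\<close> iff \<open>h\<close> lies pointwise below \<open>f\<close> and the drop \<open>f - h\<close> at
  every \<open>k\<close> in the excursion of \<open>j\<close> is at least the drop at \<open>j\<close>. Rotations have this property because
  excursions are nested or disjoint; conversely, rotating at the first index where \<open>f\<close> and \<open>h\<close> differ
  preserves it, so that \<open>h\<close> is reached from \<open>f\<close>.

  With this criterion the intervals that are chains of length \<open>l \<ge> 1\<close> turn out to be of two kinds. In the
  left kind, \<open>A E\<^sup>l B C\<close> becomes \<open>A B E\<^sup>l C\<close> for one excursion \<open>B\<close>; in the right kind,
  \<open>A E B\<^sub>1 \<dots> B\<^sub>l C\<close> becomes \<open>A B\<^sub>1 \<dots> B\<^sub>l E C\<close> for \<open>l\<close> consecutive excursions. The kinds coincide for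
  \<open>l = 1\<close> and exclude each other for \<open>l \<ge> 2\<close>. That there are no others follows by induction along the chain:
  two successive rotations, the second further to the right, commute and so span a square, unless the
  second excursion starts exactly where the first one ends.

  It remains to see that neither count depends on \<open>\<delta>\<close>. A left interval is a path with a north step
  preceded by \<open>l\<close> east steps, a notion without \<open>\<delta>\<close>. For right intervals, one excursion at a time is
  traded for a single north step: writing the excursion as \<open>N B'\<close>, the replacement of
  \<open>N B' N\<^sup>q C'\<close> by \<open>N N\<^sup>q B' C'\<close> is a bijection from the words beginning with an excursion and then
  \<open>q\<close> north steps to the words beginning with \<open>q + 1\<close> north steps. It is inverted by cutting off the shortest
  piece \<open>B'\<close> that descends back to the starting altitude, where the increments are those that the steps
  of \<open>B'\<close> have after being moved back. The path stays weakly above \<open>\<nu>\<close> because \<open>\<delta>\<close> is bounded by \<open>\<nu>\<close>, so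
  an excursion cannot cross \<open>\<nu>\<close>. After \<open>l - 1\<close> trades, right intervals of length \<open>l\<close> correspond to paths
  with a marked factor \<open>E N\<^sup>l\<close>, again a notion without \<open>\<delta>\<close>.
\<close>

section \<open>Excursions of a height function\<close>

text \<open>Here \<open>a t\<close> plays the role of the altitude in front of north step \<open>t\<close>. East steps only descend, so an
excursion that starts in front of north step \<open>j\<close> ends in front of the first later north step \<open>t\<close> with
\<open>a t \<le> a j\<close>, or earlier in the run of east steps before it. The heights in front of the north steps
therefore determine which of them it contains.\<close>
definition excursion :: "(nat \<Rightarrow> int) \<Rightarrow> nat \<Rightarrow> nat set" where
  "excursion a j = {k. j \<le> k \<and> (\<forall>t. j < t \<and> t \<le> k \<longrightarrow> a j < a t)}"

text \<open>The excursion of \<open>j\<close> ends exactly in front of north step \<open>k\<close>, so that two excursions are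
adjacent. In general it may end among the east steps that precede the next north step.\<close>
definition returns :: "(nat \<Rightarrow> int) \<Rightarrow> nat \<Rightarrow> nat \<Rightarrow> bool" where
  "returns a j k \<longleftrightarrow> j < k \<and> a k = a j \<and> (\<forall>t. j < t \<and> t < k \<longrightarrow> a j < a t)"

definition lower :: "(nat \<Rightarrow> int) \<Rightarrow> nat set \<Rightarrow> int \<Rightarrow> nat \<Rightarrow> int" where
  "lower f U m = (\<lambda>t. if t \<in> U then f t - m else f t)"

text \<open>At least \<open>m\<close> east steps immediately precede north step \<open>j\<close>. The bound \<open>m \<le> f j\<close> is the condition
for \<open>j = 0\<close>, where the path starts with its east steps.\<close>
definition slack :: "(nat \<Rightarrow> int) \<Rightarrow> nat \<Rightarrow> int \<Rightarrow> bool" where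
  "slack f j m \<longleftrightarrow> m \<le> f j \<and> (\<forall>i<j. f i + m \<le> f j)"

lemma excursion_self: "j \<in> excursion a j"
  by (auto simp: excursion_def)

lemma excursion_trans: "k \<in> excursion a j \<Longrightarrow> l \<in> excursion a k \<Longrightarrow> l \<in> excursion a j"
  unfolding excursion_def by (smt (verit) linorder_not_less mem_Collect_eq nat_less_le order_trans)

lemma excursion_ge: "k \<in> excursion a j \<Longrightarrow> a j \<le> a k"
  unfolding excursion_def by (cases "j = k") (auto intro: order_less_imp_le)

lemma excursion_between: "k \<in> excursion a j \<Longrightarrow> j \<le> t \<Longrightarrow> t \<le> k \<Longrightarrow> t \<in> excursion a j"
  by (auto simp: excursion_def)

lemma excursion_le: "k \<in> excursion a j \<Longrightarrow> j \<le> k"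
  by (auto simp: excursion_def)

lemma excursion_exit:
  assumes "j < k" "k \<notin> excursion a j"
  obtains t where "j < t" "t \<le> k" "a t \<le> a j" "t \<notin> excursion a j"
  using assms by (force simp: excursion_def not_less)

lemma excursion_if_returns: "returns a j k \<Longrightarrow> excursion a j = {j..<k}"
  unfolding returns_def excursion_def by (auto simp: not_less)

lemma returns_unique: "returns a j k \<Longrightarrow> returns a j k' \<Longrightarrow> k = k'"
  unfolding returns_def by (metis less_irrefl linorder_neqE_nat)

lemma returns_pow_unique: "(returns a ^^ m) j k \<Longrightarrow> (returns a ^^ m) j k' \<Longrightarrow> k = k'"
  by (induction m arbitrary: k k') (auto dest: returns_unique elim!: relcomppE)

text \<open>A sequence of adjacent excursions depends only on the heights between its end points, and these
never drop below the initial height.\<close>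
lemma returns_pow_cong:
  assumes "(returns a ^^ m) j k" "\<And>t. j \<le> t \<Longrightarrow> t \<le> k \<Longrightarrow> a t = b t"
  shows "(returns b ^^ m) j k \<and> j \<le> k \<and> (\<forall>t. j \<le> t \<and> t < k \<longrightarrow> a j \<le> a t) \<and> a k = a j"
  using assms
proof (induction m arbitrary: k)
  case 0
  then show ?case by auto
next
  case (Suc m)
  from Suc.prems(1) obtain p where p: "(returns a ^^ m) j p" "returns a p k" by (auto elim: relpowp_Suc_E)
  then have pk: "p < k" by (auto simp: returns_def)
  then have ih: "(returns b ^^ m) j p \<and> j \<le> p \<and> (\<forall>t. j \<le> t \<and> t < p \<longrightarrow> a j \<le> a t) \<and> a p = a j"
    by (meson Suc.IH[OF p(1)] Suc.prems(2) le_less_trans less_imp_le)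
  moreover have "returns b p k" using p(2) Suc.prems(2) ih by (auto simp: returns_def)
  moreover have "a j \<le> a t" if "j \<le> t" "t < k" for t
  proof (cases t p rule: linorder_cases)
    case greater
    then have "a p < a t" using p(2) that by (auto simp: returns_def)
    then show ?thesis using ih by simp
  qed (use ih that in auto)
  moreover have "a k = a j" using p(2) ih by (simp add: returns_def)
  ultimately show ?case using pk by auto
qed

section \<open>Rotations of integer sequences and the order criterion\<close>

text \<open>The sequence \<open>c\<close> encodes \<open>\<nu>\<close> and the sequence \<open>s\<close> consists of the partial sums of the increments. The
inequality \<open>\<delta>\<^sub>i \<le> \<nu>\<^sub>i\<close> is the monotonicity of \<open>c - s\<close>. Both sequences are meant to be constant from \<open>n\<close> on,
so that index \<open>n\<close> stands for the end of the path.\<close>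
locale nu_alt =
  fixes n :: nat and c s :: "nat \<Rightarrow> int"
  assumes s_mono: "mono s" and cs_mono: "mono (\<lambda>t. c t - s t)"
begin

definition paths :: "(nat \<Rightarrow> int) set" where
  "paths = {f. mono f \<and> 0 \<le> f 0 \<and> (\<forall>t. f t \<le> c t) \<and> (\<forall>t\<ge>n. f t = c t)}"

definition alt :: "(nat \<Rightarrow> int) \<Rightarrow> nat \<Rightarrow> int" where
  "alt f t = s t - f t"

abbreviation block :: "(nat \<Rightarrow> int) \<Rightarrow> nat \<Rightarrow> nat set" where
  "block f \<equiv> excursion (alt f)"

definition rotate :: "nat \<Rightarrow> (nat \<Rightarrow> int) \<Rightarrow> nat \<Rightarrow> int" where
  "rotate j f = lower f (block f j) 1"

definition rotations :: "(nat \<Rightarrow> int) rel" where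
  "rotations = {(f, g). f \<in> paths \<and> (\<exists>j<n. slack f j 1 \<and> g = rotate j f)}"

definition tam :: "(nat \<Rightarrow> int) rel" where
  "tam = Restr (rotations\<^sup>*) paths"

definition tam_le :: "(nat \<Rightarrow> int) \<Rightarrow> (nat \<Rightarrow> int) \<Rightarrow> bool" where
  "tam_le f h \<longleftrightarrow> (\<forall>t. h t \<le> f t) \<and> (\<forall>j<n. \<forall>k\<in>block f j. f j - h j \<le> f k - h k)"

text \<open>Every excursion closes before the path ends: since \<open>f\<close> lies below \<open>c\<close> and \<open>c - s\<close> is monotone, the
end point is not higher than any other point.\<close>
lemma block_less_n:
  assumes "f \<in> paths" "j < n" "k \<in> block f j"
  shows "k < n"
proof (rule ccontr)
  assume "\<not> k < n"
  then have "alt f j < alt f n" "f n = c n" "f j \<le> c j" using assms by (auto simp: excursion_def paths_def)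
  moreover have "c j - s j \<le> c n - s n" using monoD[OF cs_mono, of j n] assms(2) by simp
  ultimately show False by (simp add: alt_def)
qed

lemma lower_paths:
  assumes "f \<in> paths" "j < n" "slack f j m" "0 \<le> m" "U \<subseteq> {..<n}" "U \<subseteq> {j..}"
     "\<And>t u. t \<in> U \<Longrightarrow> j \<le> u \<Longrightarrow> u \<le> t \<Longrightarrow> u \<in> U"
  shows "lower f U m \<in> paths"
proof -
  have m: "mono f" using assms by (simp add: paths_def)
  have "lower f U m t \<le> lower f U m t'" if "t \<le> t'" for t t'
  proof -
    have 1: "f t \<le> f t'" using monoD[OF m that] .
    show ?thesis
    proof (cases "t' \<in> U \<and> t \<notin> U")
      case True
      then have "j \<le> t'" using assms(6) by auto
      moreover have "t < j" using True assms(7)[of t' t] that not_less by blast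
      ultimately
      have "f t + m \<le> f j" "f j \<le> f t'" using assms(3) monoD[OF m] by (auto simp: slack_def)
      then show ?thesis using True by (simp add: lower_def)
    qed (use 1 assms(4) in \<open>auto simp: lower_def\<close>)
  qed
  moreover have "0 \<le> lower f U m 0"
  proof (cases "0 \<in> U")
    case True
    then have "j = 0" using assms(6) by auto
    then show ?thesis using assms(3) True by (auto simp: slack_def lower_def)
  qed (use assms(1) in \<open>auto simp: lower_def paths_def\<close>)
  moreover have "lower f U m t \<le> c t" for t
  proof -
    have "lower f U m t \<le> f t" using assms(4) by (simp add: lower_def)
    also have "f t \<le> c t" using assms(1) by (simp add: paths_def)
    finally show ?thesis .
  qed
  moreover have "lower f U m t = c t" if "n \<le> t" for t
    using assms(1,5) that by (force simp: lower_def paths_def)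
  ultimately show ?thesis by (simp add: paths_def monoI)
qed

lemma lower_block_paths:
  assumes "f \<in> paths" "j < n" "slack f j m" "0 \<le> m"
  shows "lower f (block f j) m \<in> paths"
  by (rule lower_paths[OF assms]) (use assms in \<open>auto dest: excursion_le excursion_between block_less_n\<close>)

lemma rotate_paths: "f \<in> paths \<Longrightarrow> j < n \<Longrightarrow> slack f j 1 \<Longrightarrow> rotate j f \<in> paths"
  unfolding rotate_def by (rule lower_block_paths) auto

lemma tam_le_refl: "tam_le f f"
  by (simp add: tam_le_def)

text \<open>Moving up in the order can only enlarge excursions. This makes the criterion transitive.\<close>
lemma tam_le_block_mono:
  assumes "tam_le f h" "j < n"
  shows "block f j \<subseteq> block h j"
proof
  fix k assume k: "k \<in> block f j"
  have "alt h j < alt h t" if "j < t" "t \<le> k" for t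
  proof -
    have t: "t \<in> block f j" using k that by (auto intro: excursion_between)
    then have "f j - h j \<le> f t - h t" using assms by (auto simp: tam_le_def)
    moreover have "alt f j < alt f t" using k that by (auto simp: excursion_def)
    ultimately show ?thesis by (simp add: alt_def)
  qed
  then show "k \<in> block h j" using k by (auto simp: excursion_def)
qed

lemma tam_le_trans:
  assumes "tam_le f g" "tam_le g h"
  shows "tam_le f h"
proof -
  have "f j - h j \<le> f k - h k" if "j < n" "k \<in> block f j" for j k
  proof -
    have "k \<in> block g j" using tam_le_block_mono assms(1) that by auto
    then have "g j - h j \<le> g k - h k" "f j - g j \<le> f k - g k" using assms that by (auto simp: tam_le_def)
    then show ?thesis by simp
  qed
  then show ?thesis using assms by (auto simp: tam_le_def intro: order_trans)
qed

lemma tam_le_antisym: "tam_le f g \<Longrightarrow> tam_le g f \<Longrightarrow> f = g"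
  unfolding tam_le_def by (intro ext) (meson order_antisym)

lemma tam_le_rotate: "tam_le f (rotate j f)"
proof -
  have "k \<in> block f j" if "i \<in> block f j" "k \<in> block f i" for i k using excursion_trans that by blast
  then show ?thesis by (simp add: tam_le_def rotate_def lower_def)
qed

lemma rotations_imp_tam_le: "(f, h) \<in> rotations\<^sup>* \<Longrightarrow> tam_le f h"
  by (induction rule: rtrancl_induct) (auto simp: tam_le_refl rotations_def intro: tam_le_trans tam_le_rotate)

text \<open>The converse step of the criterion. Before \<open>i\<close> nothing has to drop, so the new constraints that
arise when the rotation enlarges the excursion of some \<open>j < i\<close> are vacuous; inside the excursion of \<open>i\<close>
both sides of a constraint decrease together.\<close>
lemma rotate_at_first_difference:
  assumes "f \<in> paths" "h \<in> paths" "tam_le f h" "h i < f i" "\<And>t. t < i \<Longrightarrow> h t = f t"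
  shows "i < n" "slack f i 1" "tam_le (rotate i f) h"
proof -
  show n: "i < n" using assms by (rule_tac ccontr) (auto simp: paths_def not_less)
  have "f t < f i" if "t < i" for t
    using assms(2,4,5) that monoD[of h t i] by (auto simp: paths_def)
  moreover have "0 < f i" using assms(2,4) monoD[of h 0 i] by (auto simp: paths_def)
  ultimately show r: "slack f i 1" by (force simp: slack_def)
  have up: "h t < f t" if "t \<in> block f i" for t
    using assms(3,4) n that by (force simp: tam_le_def)
  have "rotate i f j - h j \<le> rotate i f k - h k" if jk: "j < n" "k \<in> block (rotate i f) j" for j k
  proof (cases "j \<in> block f i")
    case True
    have "k \<in> block f j"
    proof (rule ccontr)
      assume "k \<notin> block f j"
      moreover have "j \<noteq> k" "j \<le> k" using calculation jk by (auto simp: excursion_self excursion_le)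
      ultimately obtain t where t: "j < t" "t \<le> k" "alt f t \<le> alt f j" using excursion_exit[of j k "alt f"] by auto
      then have "alt (rotate i f) j < alt (rotate i f) t" using jk(2) by (auto simp: excursion_def)
      then show False using True t(3) by (auto simp: alt_def rotate_def lower_def split: if_splits)
    qed
    then have "f j - h j \<le> f k - h k" "k \<in> block f i" using assms(3) jk(1) True
      by (auto simp: tam_le_def intro: excursion_trans)
    then show ?thesis using True by (simp add: rotate_def lower_def)
  next
    case False
    then consider "j < i" | "i < j" using excursion_self by (metis linorder_neqE_nat)
    then show ?thesis
    proof cases
      case 1
      then show ?thesis using False assms(5) up[of k] assms(3) by (auto simp: rotate_def lower_def tam_le_def)
    next
      case 2
      have out: "t \<notin> block f i" if "j \<le> t" for t
        using False 2 that excursion_between[of t _ i j] by auto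
      then have same: "rotate i f t = f t" if "j \<le> t" for t using that by (simp add: rotate_def lower_def)
      have "k \<in> block f j" using jk(2) same by (auto simp: excursion_def alt_def)
      then show ?thesis using same[of j] same[of k] excursion_le[OF jk(2)] assms(3) jk(1) by (auto simp: tam_le_def)
    qed
  qed
  moreover have "h t \<le> rotate i f t" for t
    using up[of t] assms(3) by (auto simp: rotate_def lower_def tam_le_def)
  ultimately show "tam_le (rotate i f) h" by (auto simp: tam_le_def)
qed

lemma first_difference:
  assumes "tam_le f h" "f \<noteq> h"
  obtains i where "h i < f i" "\<And>t. t < i \<Longrightarrow> h t = f t"
proof -
  have "\<exists>i. h i \<noteq> f i" using assms by auto
  then obtain i where i: "h i \<noteq> f i" "\<And>t. t < i \<Longrightarrow> h t = f t"
    using exists_least_iff[of "\<lambda>i. h i \<noteq> f i"] by auto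
  then have "h i < f i" using assms(1) by (auto simp: tam_le_def order_less_le)
  then show ?thesis using that i(2) by blast
qed

lemma tam_le_imp_rotations:
  assumes "f \<in> paths" "h \<in> paths" "tam_le f h"
  shows "(f, h) \<in> rotations\<^sup>*"
  using assms
proof (induction "nat (\<Sum>t<n. f t - h t)" arbitrary: f rule: less_induct)
  case less
  show ?case
  proof (cases "f = h")
    case False
    then obtain i where i: "h i < f i" "\<And>t. t < i \<Longrightarrow> h t = f t" using first_difference less.prems(3) by metis
    note m = rotate_at_first_difference[OF less.prems i]
    have p: "rotate i f \<in> paths" using rotate_paths less.prems m by auto
    have le: "rotate i f t \<le> f t" for t by (simp add: rotate_def lower_def)
    have lt: "rotate i f i < f i" by (simp add: rotate_def lower_def excursion_self)
    have "(\<Sum>t<n. rotate i f t - h t) < (\<Sum>t<n. f t - h t)"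
      by (rule sum_strict_mono_ex1) (use le lt m(1) in auto)
    moreover have "0 \<le> (\<Sum>t<n. rotate i f t - h t)"
      by (rule sum_nonneg) (use m(3) in \<open>auto simp: tam_le_def\<close>)
    ultimately have "(rotate i f, h) \<in> rotations\<^sup>*" using less.hyps p less.prems m by auto
    moreover have "(f, rotate i f) \<in> rotations" using less.prems m by (auto simp: rotations_def)
    ultimately show ?thesis by (meson converse_rtrancl_into_rtrancl)
  qed simp
qed

lemma tam_iff: "(f, h) \<in> tam \<longleftrightarrow> f \<in> paths \<and> h \<in> paths \<and> tam_le f h"
  using tam_le_imp_rotations rotations_imp_tam_le by (auto simp: tam_def)


section \<open>The two kinds of linear intervals\<close>

text \<open>The result of rotating \<open>m\<close> times at the same north step: the excursion of \<open>j\<close> does not change in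
the process.\<close>
definition rotate_by :: "nat \<Rightarrow> int \<Rightarrow> (nat \<Rightarrow> int) \<Rightarrow> nat \<Rightarrow> int" where
  "rotate_by j m f = lower f (block f j) m"

lemma rotate_eq_rotate_by: "rotate j f = rotate_by j 1 f"
  by (simp add: rotate_def rotate_by_def)

lemma rotate_by_in: "t \<in> block f j \<Longrightarrow> rotate_by j m f t = f t - m"
  and rotate_by_out: "t \<notin> block f j \<Longrightarrow> rotate_by j m f t = f t"
  by (simp_all add: rotate_by_def lower_def)

lemma rotate_by_self: "rotate_by j m f j = f j - m"
  by (simp add: rotate_by_in excursion_self)

lemma slack_mono: "slack f j m \<Longrightarrow> m' \<le> m \<Longrightarrow> slack f j m'"
  unfolding slack_def by force

lemma rotate_by_paths: "f \<in> paths \<Longrightarrow> j < n \<Longrightarrow> slack f j m \<Longrightarrow> 0 \<le> m \<Longrightarrow> rotate_by j m f \<in> paths"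
  unfolding rotate_by_def by (rule lower_block_paths)

lemma block_rotate_by:
  assumes "t \<in> block f j" "0 \<le> m"
  shows "block (rotate_by j m f) t = block f t"
proof (intro equalityI subsetI)
  fix k assume k: "k \<in> block f t"
  have "alt (rotate_by j m f) t < alt (rotate_by j m f) u" if "t < u" "u \<le> k" for u
  proof -
    have "u \<in> block f t" using k that by (auto intro: excursion_between)
    then have "u \<in> block f j" using assms(1) excursion_trans by blast
    moreover have "alt f t < alt f u" using k that by (auto simp: excursion_def)
    ultimately show ?thesis using assms(1) by (simp add: alt_def rotate_by_in)
  qed
  then show "k \<in> block (rotate_by j m f) t" using k by (auto simp: excursion_def)
next
  fix k assume k: "k \<in> block (rotate_by j m f) t"
  show "k \<in> block f t"
  proof (rule ccontr)
    assume c: "k \<notin> block f t"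
    then have "t \<noteq> k" "t \<le> k" using k by (auto simp: excursion_self excursion_le)
    then obtain u where u: "t < u" "u \<le> k" "alt f u \<le> alt f t" using c excursion_exit[of t k "alt f"] by auto
    then have "alt (rotate_by j m f) t < alt (rotate_by j m f) u" using k by (auto simp: excursion_def)
    then show False using assms u(3) by (cases "u \<in> block f j") (auto simp: alt_def rotate_by_in rotate_by_out)
  qed
qed

lemma tam_le_rotate_by:
  assumes "0 \<le> m" "m \<le> m'"
  shows "tam_le (rotate_by j m f) (rotate_by j m' f)"
proof -
  have le: "rotate_by j m' f t \<le> rotate_by j m f t" for t
    using assms by (simp add: rotate_by_def lower_def)
  have "rotate_by j m f t - rotate_by j m' f t \<le> rotate_by j m f k - rotate_by j m' f k" if "k \<in> block (rotate_by j m f) t" for t k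
  proof (cases "t \<in> block f j")
    case True
    then have "k \<in> block f j" using block_rotate_by assms(1) that excursion_trans by blast
    then show ?thesis using True by (simp add: rotate_by_in)
  next
    case False
    then show ?thesis using le[of k] by (simp add: rotate_by_out)
  qed
  then show ?thesis using le by (auto simp: tam_le_def)
qed

lemma rotate_by_0: "rotate_by j 0 f = f"
  by (auto simp: rotate_by_def lower_def)

lemma mem_interval:
  "f \<in> paths \<Longrightarrow> h \<in> paths \<Longrightarrow> R \<in> interval tam f h \<longleftrightarrow> R \<in> paths \<and> tam_le f R \<and> tam_le R h"
  by (auto simp: interval_def tam_iff)

definition linear_interval :: "nat \<Rightarrow> (nat \<Rightarrow> int) \<Rightarrow> (nat \<Rightarrow> int) \<Rightarrow> bool" where
  "linear_interval l f h \<longleftrightarrow> f \<in> paths \<and> h \<in> paths \<and> tam_le f h \<and>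
     (\<forall>R\<in>interval tam f h. \<forall>S\<in>interval tam f h. tam_le R S \<or> tam_le S R) \<and>
     card (interval tam f h) = l + 1"

definition left_type :: "nat \<Rightarrow> (nat \<Rightarrow> int) \<Rightarrow> (nat \<Rightarrow> int) \<Rightarrow> nat \<Rightarrow> bool" where
  "left_type l f h j \<longleftrightarrow> f \<in> paths \<and> j < n \<and> slack f j (int l) \<and> h = rotate_by j (int l) f"

text \<open>The parameter is the length minus one: the excursion of \<open>j\<close> is followed by \<open>m\<close> further adjacent
excursions, the last of which starts at \<open>k\<close>. Together they occupy \<open>{j..<k} \<union> block f k\<close>.\<close>
definition right_type :: "nat \<Rightarrow> (nat \<Rightarrow> int) \<Rightarrow> (nat \<Rightarrow> int) \<Rightarrow> nat \<Rightarrow> bool" where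
  "right_type m f h j \<longleftrightarrow> f \<in> paths \<and> slack f j 1 \<and>
     (\<exists>k<n. (returns (alt f) ^^ m) j k \<and> h = lower f ({j..<k} \<union> block f k) 1)"

text \<open>Between \<open>f\<close> and \<open>h\<close>, the criterion for the lower half says that the drop on the excursion is at
least the drop at \<open>j\<close>, and for the upper half that it is at most the drop at \<open>j\<close>. So the drop is
constant on the excursion.\<close>
lemma left_interval:
  assumes "left_type l f h j"
  shows "interval tam f h = (\<lambda>m. rotate_by j (int m) f) ` {0..l}"
proof -
  have f: "f \<in> paths" "j < n" "slack f j (int l)" and h: "h = rotate_by j (int l) f" using assms by (auto simp: left_type_def)
  have hp: "h \<in> paths" using f h by (simp add: rotate_by_paths)
  show ?thesis
  proof (intro equalityI subsetI)
    fix R assume "R \<in> interval tam f h"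
    then have R: "tam_le f R" "tam_le R h" using mem_interval f(1) hp by auto
    define m where "m = f j - R j"
    have "R t = rotate_by j m f t" for t
    proof (cases "t \<in> block f j")
      case True
      moreover have "t \<in> block R j" using True tam_le_block_mono[OF R(1) f(2)] by auto
      ultimately have "f j - R j \<le> f t - R t" "R j - h j \<le> R t - h t" using R f(2) by (auto simp: tam_le_def)
      then show ?thesis using True h by (simp add: rotate_by_in rotate_by_self m_def)
    next
      case False
      then have "h t = f t" using h by (simp add: rotate_by_out)
      moreover have "h t \<le> R t" "R t \<le> f t" using R by (auto simp: tam_le_def)
      ultimately show ?thesis using False by (simp add: rotate_by_out)
    qed
    then have eq: "R = rotate_by j m f" by (rule ext)
    have "h j \<le> R j" "R j \<le> f j" using R by (auto simp: tam_le_def)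
    then have "0 \<le> m" "m \<le> int l" using h by (auto simp: rotate_by_self m_def)
    then have "R = rotate_by j (int (nat m)) f" "nat m \<in> {0..l}" using eq by auto
    then show "R \<in> (\<lambda>m. rotate_by j (int m) f) ` {0..l}" by blast
  next
    fix R assume "R \<in> (\<lambda>m. rotate_by j (int m) f) ` {0..l}"
    then obtain m where m: "R = rotate_by j (int m) f" "m \<le> l" by auto
    have "slack f j (int m)" using f(3) m(2) slack_mono by auto
    then have "R \<in> paths" using m f rotate_by_paths by auto
    moreover have "tam_le f R" "tam_le R h" using m h tam_le_rotate_by[of 0 "int m" j f] tam_le_rotate_by[of "int m" "int l" j f] by (auto simp: rotate_by_0)
    ultimately show "R \<in> interval tam f h" using mem_interval f(1) hp by auto
  qed
qed

lemma left_type_linear: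
  assumes "left_type l f h j"
  shows "linear_interval l f h"
proof -
  have f: "f \<in> paths" "j < n" "slack f j (int l)" and h: "h = rotate_by j (int l) f" using assms by (auto simp: left_type_def)
  have "inj_on (\<lambda>m. rotate_by j (int m) f) {0..l}"
  proof (rule inj_onI)
    fix x y assume "rotate_by j (int x) f = rotate_by j (int y) f"
    then have "rotate_by j (int x) f j = rotate_by j (int y) f j" by simp
    then show "x = y" by (simp add: rotate_by_self)
  qed
  then have "card (interval tam f h) = l + 1" by (simp add: left_interval[OF assms] card_image)
  moreover have "tam_le R S \<or> tam_le S R" if RS: "R \<in> interval tam f h" "S \<in> interval tam f h" for R S
  proof -
    obtain x where x: "R = rotate_by j (int x) f" using RS(1) unfolding left_interval[OF assms] by auto
    obtain y where y: "S = rotate_by j (int y) f" using RS(2) unfolding left_interval[OF assms] by auto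
    show ?thesis unfolding x y by (cases "x \<le> y") (simp_all add: tam_le_rotate_by)
  qed
  moreover have "tam_le f h" using tam_le_rotate_by[of 0 "int l" j f] h by (simp add: rotate_by_0)
  ultimately show ?thesis using f h rotate_by_paths by (auto simp: linear_interval_def)
qed

text \<open>If every element other than \<open>f\<close> lies above one fixed rotation of \<open>f\<close>, then \<open>f\<close> can be removed from the
bottom of the interval. This is the induction step for lengths in both directions.\<close>
lemma interval_split:
  assumes "f \<in> paths" "h \<in> paths" "i < n" "slack f i 1" "tam_le (rotate i f) h"
    and "\<And>R. R \<in> interval tam f h \<Longrightarrow> R \<noteq> f \<Longrightarrow> tam_le (rotate i f) R"
  shows "interval tam f h = insert f (interval tam (rotate i f) h)" "f \<notin> interval tam (rotate i f) h"
proof -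
  have p: "rotate i f \<in> paths" using assms rotate_paths by auto
  have "tam_le f h" using tam_le_rotate assms(5) tam_le_trans by blast
  moreover have "tam_le f R" if "tam_le (rotate i f) R" for R using that tam_le_rotate tam_le_trans by blast
  ultimately show "interval tam f h = insert f (interval tam (rotate i f) h)"
    using assms(1,2,6) p tam_le_refl[of f] mem_interval[OF assms(1,2)] mem_interval[OF p assms(2)] by blast
  have "\<not> f i \<le> rotate i f i" by (simp add: rotate_eq_rotate_by rotate_by_self)
  then show "f \<notin> interval tam (rotate i f) h" using assms p by (auto simp: mem_interval tam_le_def)
qed

lemma linear_interval_prepend:
  assumes "f \<in> paths" "i < n" "slack f i 1" "linear_interval l (rotate i f) h"
    and "\<And>R. R \<in> interval tam f h \<Longrightarrow> R \<noteq> f \<Longrightarrow> tam_le (rotate i f) R"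
  shows "linear_interval (Suc l) f h"
proof -
  have h: "h \<in> paths" "tam_le (rotate i f) h" using assms(4) by (auto simp: linear_interval_def)
  note sp = interval_split[OF assms(1) h(1) assms(2,3) h(2) assms(5)]
  have "finite (interval tam (rotate i f) h)" using assms(4) by (auto simp: linear_interval_def intro: card_ge_0_finite)
  then have "card (interval tam f h) = Suc l + 1" using sp assms(4) by (simp add: linear_interval_def)
  moreover have "tam_le R S \<or> tam_le S R" if RS: "R \<in> interval tam f h" "S \<in> interval tam f h" for R S
  proof (cases "R = f \<or> S = f")
    case True
    then show ?thesis using RS assms(1) h(1) by (auto simp: mem_interval)
  next
    case False
    then have "R \<in> interval tam (rotate i f) h" "S \<in> interval tam (rotate i f) h" using RS sp(1) by auto
    then show ?thesis using assms(4) by (simp add: linear_interval_def)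
  qed
  moreover have "tam_le f h" using tam_le_rotate h(2) tam_le_trans by blast
  ultimately show ?thesis using assms(1) h(1) by (simp add: linear_interval_def)
qed

lemma linear_interval_tail:
  assumes "linear_interval (Suc l) f h" "h i < f i" "\<And>t. t < i \<Longrightarrow> h t = f t"
  shows "linear_interval l (rotate i f) h"
proof -
  have fh: "f \<in> paths" "h \<in> paths" "tam_le f h" using assms(1) by (auto simp: linear_interval_def)
  note m = rotate_at_first_difference[OF fh assms(2,3)]
  have p: "rotate i f \<in> paths" using rotate_paths fh m by auto
  have l1: "left_type 1 f (rotate i f) i" using fh m by (simp add: left_type_def rotate_eq_rotate_by)
  have "tam_le (rotate i f) R" if R: "R \<in> interval tam f h" "R \<noteq> f" for R
  proof -
    have "rotate i f \<in> interval tam f h" using p fh m(3) tam_le_rotate by (simp add: mem_interval)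
    then consider "tam_le (rotate i f) R" | "tam_le R (rotate i f)" using assms(1) R(1) unfolding linear_interval_def by blast
    then show ?thesis
    proof cases
      case 2
      have "R \<in> interval tam f (rotate i f)" using 2 R(1) p fh by (simp add: mem_interval)
      then have "R = rotate_by i 0 f \<or> R = rotate_by i 1 f" using left_interval[OF l1] by (auto simp: le_Suc_eq)
      then show ?thesis using R(2) by (auto simp: rotate_by_0 rotate_eq_rotate_by tam_le_refl)
    qed simp
  qed
  note sp = interval_split[OF fh(1,2) m this]
  have "finite (interval tam f h)" using assms(1) by (auto simp: linear_interval_def intro: card_ge_0_finite)
  then have "card (interval tam (rotate i f) h) = l + 1" using sp assms(1) by (simp add: linear_interval_def)
  then show ?thesis using assms(1) p fh m sp(1) by (auto simp: linear_interval_def)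
qed

text \<open>An interval that lowers a whole block \<open>U\<close> by one, where no altitude in \<open>U\<close> is below the one at its
left end \<open>j\<close>, has the rotation at \<open>j\<close> as its only way up. Suppose instead that \<open>R\<close> differs from \<open>f\<close> first
at \<open>i > j\<close>. In \<open>R\<close> the altitude at \<open>i\<close> has grown, so \<open>i\<close> belongs to the excursion of the nearest \<open>p < i\<close>
whose altitude was at most that of \<open>i\<close>. On the way to \<open>h\<close> the entry at \<open>p\<close> still has to drop but the
entry at \<open>i\<close> cannot, which contradicts the criterion.\<close>
lemma rotate_first_in_interval:
  assumes "f \<in> paths" "h \<in> paths" "h = lower f U 1" "j \<in> U" "\<And>t. t \<in> U \<Longrightarrow> j \<le> t"
    "\<And>t u. t \<in> U \<Longrightarrow> j \<le> u \<Longrightarrow> u \<le> t \<Longrightarrow> u \<in> U" "\<And>t. t \<in> U \<Longrightarrow> alt f j \<le> alt f t"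
    "R \<in> interval tam f h" "R \<noteq> f"
  shows "tam_le (rotate j f) R"
proof -
  have R: "R \<in> paths" "tam_le f R" "tam_le R h" using assms(8) mem_interval[OF assms(1,2)] by auto
  obtain i where i: "R i < f i" "\<And>t. t < i \<Longrightarrow> R t = f t" using first_difference R(2) assms(9) by metis
  note m = rotate_at_first_difference[OF assms(1) R(1,2) i]
  have "h i \<le> R i" using R(3) by (auto simp: tam_le_def)
  then have iU: "i \<in> U" "h i = R i" using i(1) assms(3) by (auto simp: lower_def split: if_splits)
  have "i = j"
  proof (rule ccontr)
    assume "i \<noteq> j"
    then have ji: "j < i" using assms(5) iU by force
    define p where "p = (GREATEST p. p < i \<and> alt f p \<le> alt f i)"
    have block: "j < i \<and> alt f j \<le> alt f i" using ji iU assms(7) by auto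
    have p: "p < i \<and> alt f p \<le> alt f i" unfolding p_def
      by (rule GreatestI_nat[of _ j i]) (use block in auto)
    have pm: "q \<le> p" if "q < i \<and> alt f q \<le> alt f i" for q unfolding p_def
      by (rule Greatest_le_nat[of _ q i]) (use that in auto)
    have jp: "j \<le> p" using pm block by simp
    have "alt R p < alt R t" if "p < t" "t \<le> i" for t
    proof (cases "t = i")
      case True
      then show ?thesis using p i by (simp add: alt_def)
    next
      case False
      then have "alt f i < alt f t" using pm[of t] that by force
      then show ?thesis using False that p i(2)[of t] i(2)[of p] by (simp add: alt_def)
    qed
    then have "i \<in> block R p" using p by (auto simp: excursion_def)
    then have "R p - h p \<le> R i - h i" using R(3) p m(1) by (auto simp: tam_le_def)
    moreover have "p \<in> U" using assms(6) iU jp p by auto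
    ultimately show False using i(2)[of p] p iU assms(3) by (simp add: lower_def)
  qed
  then show ?thesis using m(3) by simp
qed

lemma returns_rotate_by:
  assumes "returns (alt f) j j'"
  shows "block f j = {j..<j'}" "\<And>t. j' \<le> t \<Longrightarrow> rotate_by j m f t = f t"
  using excursion_if_returns[OF assms] by (auto simp: rotate_by_out)

lemma block_cong: "(\<And>t. k \<le> t \<Longrightarrow> f t = g t) \<Longrightarrow> block f k = block g k"
  by (auto simp: excursion_def alt_def)

lemma returns_pow_le: "(returns a ^^ m) j k \<Longrightarrow> j \<le> k"
  using returns_pow_cong by blast

lemma lower_rotate_block:
  assumes "block f j = {j..<j'}" "j < j'" "j' \<le> k"
  shows "lower (rotate j f) ({j'..<k} \<union> block f k) 1 = lower f ({j..<k} \<union> block f k) 1"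
proof
  fix u
  have "rotate j f u = (if j \<le> u \<and> u < j' then f u - 1 else f u)"
    using assms(1) by (simp add: rotate_def lower_def)
  moreover have "u \<in> block f k \<Longrightarrow> k \<le> u" by (rule excursion_le)
  ultimately show "lower (rotate j f) ({j'..<k} \<union> block f k) 1 u = lower f ({j..<k} \<union> block f k) 1 u"
    using assms(2,3) by (auto simp: lower_def)
qed

text \<open>The recursive structure of right intervals: rotating the first of several adjacent excursions
leaves a right interval for the remaining ones. The two directions serve the classification and the
proof of linearity.\<close>
lemma right_Suc:
  assumes "f \<in> paths" "slack f j 1" "returns (alt f) j j'" "right_type m (rotate j f) h j'"
  shows "right_type (Suc m) f h j"
proof -
  obtain k where k: "k < n" "(returns (alt (rotate j f)) ^^ m) j' k"
    and h: "h = lower (rotate j f) ({j'..<k} \<union> block (rotate j f) k) 1"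
    using assms(4) by (auto simp: right_type_def)
  have jk: "j < j'" "j' \<le> k" using assms(3) k(2) returns_pow_le by (auto simp: returns_def)
  note t = returns_rotate_by[OF assms(3)]
  have "(returns (alt f) ^^ m) j' k"
    using returns_pow_cong[OF k(2), of "alt f"] t(2) by (simp add: alt_def rotate_eq_rotate_by)
  then have 1: "(returns (alt f) ^^ Suc m) j k" using assms(3) relpowp_Suc_I2 by metis
  have 2: "block (rotate j f) k = block f k" by (rule block_cong) (use t jk in \<open>simp add: rotate_eq_rotate_by\<close>)
  have "h = lower f ({j..<k} \<union> block f k) 1"
    unfolding h 2 using lower_rotate_block[OF t(1) jk] by simp
  then show ?thesis using 1 k(1) assms by (auto simp: right_type_def)
qed

lemma right_Suc_D:
  assumes "right_type (Suc m) f h j"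
  obtains j' where "returns (alt f) j j'" "j < n" "slack f j 1" "right_type m (rotate j f) h j'"
proof -
  obtain k where k: "k < n" "(returns (alt f) ^^ Suc m) j k"  and h: "h = lower f ({j..<k} \<union> block f k) 1"
    and f: "f \<in> paths" "slack f j 1"
    using assms by (auto simp: right_type_def)
  obtain j' where j': "returns (alt f) j j'" "(returns (alt f) ^^ m) j' k" using k(2) relpowp_Suc_D2 by metis
  have jk: "j < j'" "j' \<le> k" using j' returns_pow_le by (auto simp: returns_def)
  note t = returns_rotate_by[OF j'(1)]
  have p: "rotate j f \<in> paths" using f jk k by (auto intro: rotate_paths)
  have 1: "(returns (alt (rotate j f)) ^^ m) j' k"
    using returns_pow_cong[OF j'(2), of "alt (rotate j f)"] t(2) by (simp add: alt_def rotate_eq_rotate_by)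
  have 2: "block (rotate j f) k = block f k" by (rule block_cong) (use t jk in \<open>simp add: rotate_eq_rotate_by\<close>)
  have 3: "h = lower (rotate j f) ({j'..<k} \<union> block (rotate j f) k) 1"
    unfolding h 2 using lower_rotate_block[OF t(1) jk] by simp
  have "rotate j f i + 1 \<le> rotate j f j'" if "i < j'" for i
  proof -
    have m: "mono f" using f by (simp add: paths_def)
    have "rotate j f j' = f j'" using t(2) by (simp add: rotate_eq_rotate_by)
    moreover have "rotate j f i + 1 \<le> f j'"
    proof (cases "i < j")
      case True
      then have "f i + 1 \<le> f j" using f(2) by (simp add: slack_def)
      moreover have "f j \<le> f j'" using monoD[OF m, of j j'] jk by simp
      moreover have "rotate j f i = f i" using True t(1) by (simp add: rotate_eq_rotate_by rotate_by_out)
      ultimately show ?thesis by simp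
    next
      case False
      then show ?thesis using that t(1) monoD[OF m, of i j'] by (simp add: rotate_eq_rotate_by rotate_by_in)
    qed
    ultimately show ?thesis by simp
  qed
  moreover have "1 \<le> rotate j f j'"
  proof -
    have "0 \<le> rotate j f 0" "rotate j f 0 \<le> rotate j f j" using p by (auto simp: paths_def intro: monoD)
    then show ?thesis using calculation[of j] jk by simp
  qed
  ultimately have "slack (rotate j f) j' 1" by (simp add: slack_def)
  then have "right_type m (rotate j f) h j'" unfolding right_type_def using p k(1) 1 3 by blast
  moreover have "j < n" using jk k(1) by simp
  ultimately show ?thesis by (intro that[of j'] j'(1) f(2))
qed

lemma right_0: "right_type 0 f h j \<longleftrightarrow> left_type 1 f h j"
  by (auto simp: right_type_def left_type_def rotate_by_def)

text \<open>The steps that rotate \<open>B\<^sub>1\<close>, then \<open>B\<^sub>2\<close>, and so on are the only ones possible.\<close>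
lemma right_type_linear: "right_type m f h j \<Longrightarrow> linear_interval (Suc m) f h"
proof (induction m arbitrary: f j)
  case 0
  then have "left_type 1 f h j" by (simp only: right_0)
  then show ?case using left_type_linear[of 1] by simp
next
  case (Suc m)
  obtain k where k: "k < n" "(returns (alt f) ^^ Suc m) j k" and h: "h = lower f ({j..<k} \<union> block f k) 1"
    and f: "f \<in> paths" "slack f j 1"
    using Suc.prems by (auto simp: right_type_def)
  have r: "j \<le> k" "\<And>t. j \<le> t \<Longrightarrow> t < k \<Longrightarrow> alt f j \<le> alt f t" "alt f k = alt f j"
    using returns_pow_cong[OF k(2)] by auto
  obtain j' where j': "j < n" "right_type m (rotate j f) h j'" using right_Suc_D Suc.prems by metis
  have c: "linear_interval (Suc m) (rotate j f) h" using Suc.IH j'(2) .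
  then have hp: "h \<in> paths" by (simp add: linear_interval_def)
  have "tam_le (rotate j f) R" if "R \<in> interval tam f h" "R \<noteq> f" for R
    using f(1) hp h
  proof (rule rotate_first_in_interval)
    show "j \<in> {j..<k} \<union> block f k" using r(1) by (cases "j = k") (auto simp: excursion_self)
    show "alt f j \<le> alt f t" if "t \<in> {j..<k} \<union> block f k" for t
      using that r excursion_ge[of t "alt f" k] by auto
    show "j \<le> t" if "t \<in> {j..<k} \<union> block f k" for t using that r(1) by (auto dest: excursion_le)
    show "u \<in> {j..<k} \<union> block f k" if "t \<in> {j..<k} \<union> block f k" "j \<le> u" "u \<le> t" for t u
      using that excursion_between[of t "alt f" k u] by (cases "u < k") auto
  qed (use that in auto)
  then show ?case using linear_interval_prepend f j'(1) c by blast
qed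


section \<open>There are no other linear intervals\<close>
lemma rotate_in: "t \<in> block f j \<Longrightarrow> rotate j f t = f t - 1"
  and rotate_out: "t \<notin> block f j \<Longrightarrow> rotate j f t = f t"
  by (simp_all add: rotate_eq_rotate_by rotate_by_in rotate_by_out)

lemma rotate_bounds: "rotate j f t \<le> f t" "f t \<le> rotate j f t + 1"
  by (simp_all add: rotate_def lower_def)

lemma not_block_above: "i < j \<Longrightarrow> j \<notin> block f i \<Longrightarrow> j \<le> t \<Longrightarrow> t \<notin> block f i"
  using excursion_between[of t "alt f" i j] by auto

lemma block_rotate_later:
  assumes "i < j"
  shows "block (rotate i f) j = block f j"
proof (cases "j \<in> block f i")
  case True
  then show ?thesis by (simp add: rotate_eq_rotate_by block_rotate_by)
next
  case False
  then show ?thesis using not_block_above[OF assms] by (intro block_cong) (auto simp: rotate_out)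
qed

text \<open>A rotation at a later \<open>j\<close> raises altitudes on the excursion of \<open>j\<close>. This can reopen the excursion
of \<open>i\<close> only if that one ended exactly in front of \<open>j\<close>.\<close>
lemma block_rotate_earlier:
  assumes "i < j" "\<not> returns (alt f) i j"
  shows "block (rotate j f) i = block f i"
proof (intro equalityI)
  show "block f i \<subseteq> block (rotate j f) i"
  proof
    fix k assume k: "k \<in> block f i"
    have "i \<notin> block f j" using assms(1) by (auto simp: excursion_def)
    then have "alt (rotate j f) i < alt (rotate j f) t" if "i < t" "t \<le> k" for t
      using k that rotate_bounds(1)[of j f t] by (auto simp: excursion_def alt_def rotate_out)
    then show "k \<in> block (rotate j f) i" using k by (auto simp: excursion_def)
  qed
  show "block (rotate j f) i \<subseteq> block f i"
  proof
    fix k assume k: "k \<in> block (rotate j f) i"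
    have i: "i \<notin> block f j" using assms(1) by (auto simp: excursion_def)
    have up: "alt f i < alt (rotate j f) t" if "i < t" "t \<le> k" for t
      using k that i by (auto simp: excursion_def alt_def rotate_out)
    have "alt f i < alt f t" if t: "i < t" "t \<le> k" for t
    proof (cases "t \<in> block f j")
      case True
      have ge: "alt f j \<le> alt f t" "j \<le> t" using True by (auto dest: excursion_ge excursion_le)
      have j: "alt f i \<le> alt f j" using up[of j] assms(1) ge t by (auto simp: alt_def rotate_eq_rotate_by rotate_by_self)
      have "alt f i \<noteq> alt f j"
      proof
        assume eq: "alt f i = alt f j"
        have "alt f i < alt f u" if "i < u" "u < j" for u
        proof -
          have "u \<notin> block f j" using that by (auto simp: excursion_def)
          then show ?thesis using up[of u] that ge t by (simp add: alt_def rotate_out)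
        qed
        then show False using assms eq by (auto simp: returns_def)
      qed
      then show ?thesis using ge j by simp
    next
      case False
      then show ?thesis using up[OF t] by (simp add: alt_def rotate_out)
    qed
    then show "k \<in> block f i" using k by (auto simp: excursion_def)
  qed
qed

text \<open>If a valley in front of \<open>j\<close> is created by the rotation at \<open>i\<close>, then the excursion of \<open>i\<close> ended right
there: the rotated east step was put just before \<open>j\<close>. (This happens for excursions that consist of a
single north step with increment 0.)\<close>
lemma slack_before_rotate:
  assumes "f \<in> paths" "i < j" "slack (rotate i f) j 1" "\<not> returns (alt f) i j"
  shows "slack f j 1"
proof -
  have m: "mono f" using assms(1) by (simp add: paths_def)
  have lt: "f t < f j" if "t < j" for t
  proof (cases "j \<in> block f i")
    case True
    then show ?thesis using assms(3) that rotate_bounds(2)[of f t i] by (force simp: slack_def rotate_in)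
  next
    case False
    note out = not_block_above[OF assms(2) False]
    have r: "rotate i f u + 1 \<le> f j" if "u < j" for u
      using assms(3) that out[of j] by (auto simp: slack_def rotate_out)
    show ?thesis
    proof (rule ccontr)
      assume "\<not> f t < f j"
      then have eq: "f t = f j" using monoD[OF m, of t j] that by simp
      then have t: "t \<in> block f i" using r[OF that] by (rule_tac ccontr) (simp add: rotate_out)
      have ge: "alt f i \<le> alt f j"
        using excursion_ge[OF t] eq monoD[OF s_mono, of t j] that by (simp add: alt_def)
      obtain u where u: "i < u" "u \<le> j" "alt f u \<le> alt f i" "u \<notin> block f i"
        using excursion_exit[OF assms(2) False] .
      have tu: "t < u" using t u excursion_between[of t "alt f" i u] by force
      have "u = j"
      proof (rule ccontr)
        assume "u \<noteq> j"
        then have "f u = f j" using eq tu u monoD[OF m, of t u] monoD[OF m, of u j] by simp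
        then show False using r[of u] u \<open>u \<noteq> j\<close> by (simp add: rotate_out)
      qed
      then have aj: "alt f j = alt f i" using u ge by simp
      have "alt f i < alt f v" if "i < v" "v < j" for v
      proof (cases "v \<in> block f i")
        case False
        then have tv: "t < v" using t that excursion_between[of t "alt f" i v] by force
        then have "f v = f j" using eq that monoD[OF m, of t v] monoD[OF m, of v j] by simp
        then show ?thesis using r[of v] that False by (simp add: rotate_out)
      qed (use that in \<open>auto simp: excursion_def\<close>)
      then show False using assms(2,4) aj by (auto simp: returns_def)
    qed
  qed
  have "0 < f j"
    using assms(3) rotate_bounds(1)[of i f j] by (simp add: slack_def)
  then show ?thesis using lt by (force simp: slack_def)
qed

lemma rotate_commute:
  assumes "i < j" "\<not> returns (alt f) i j"
  shows "rotate i (rotate j f) = rotate j (rotate i f)"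
proof -
  have e: "block (rotate j f) i = block f i" "block (rotate i f) j = block f j"
    using block_rotate_earlier[OF assms] block_rotate_later[OF assms(1)] by auto
  show ?thesis unfolding rotate_def[of i "rotate j f"] rotate_def[of j "rotate i f"] e
    by (auto simp: lower_def rotate_def)
qed

lemma linear_interval_0: "linear_interval 0 f h \<longleftrightarrow> f \<in> paths \<and> f = h"
proof
  assume c: "linear_interval 0 f h"
  then have "f \<in> interval tam f h" "h \<in> interval tam f h" "card (interval tam f h) = 1"
    by (auto simp: linear_interval_def mem_interval tam_le_refl)
  then show "f \<in> paths \<and> f = h" using c by (metis card_1_singletonE singletonD linear_interval_def)
next
  assume f: "f \<in> paths \<and> f = h"
  then have "interval tam f h = {f}" using tam_le_refl tam_le_antisym by (auto simp: mem_interval)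
  then show "linear_interval 0 f h" using f by (auto simp: linear_interval_def tam_le_refl)
qed

lemma linear_interval_Suc_neq: "linear_interval (Suc l) f h \<Longrightarrow> f \<noteq> h"
  using linear_interval_0[of f f] by (auto simp: linear_interval_def tam_le_refl)

text \<open>Two rotations at different places give incomparable paths, so a linear interval contains only one
of them.\<close>
lemma linear_interval_unique_atom:
  assumes "linear_interval l f h" "i < j" "j < n" "slack f i 1" "slack f j 1" "tam_le (rotate i f) h" "tam_le (rotate j f) h"
  shows False
proof -
  have fh: "f \<in> paths" "h \<in> paths" using assms(1) by (auto simp: linear_interval_def)
  have i: "i < n" using assms by simp
  have p: "rotate i f \<in> paths" "rotate j f \<in> paths" using rotate_paths fh assms i by auto
  have "rotate i f \<in> interval tam f h" "rotate j f \<in> interval tam f h"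
    using mem_interval[OF fh] p assms(6,7) tam_le_rotate by auto
  then consider "tam_le (rotate i f) (rotate j f)" | "tam_le (rotate j f) (rotate i f)"
    using assms(1) unfolding linear_interval_def by blast
  then show False
  proof cases
    case 1
    moreover have "i \<notin> block f j" using assms(2) by (auto simp: excursion_def)
    ultimately have "f i \<le> rotate i f i" unfolding tam_le_def by (metis rotate_out)
    then show False by (simp add: rotate_eq_rotate_by rotate_by_self)
  next
    case 2
    then have "rotate i f j \<le> rotate j f j" by (simp add: tam_le_def)
    then have j: "j \<in> block f i" by (rule_tac ccontr) (simp add: rotate_out rotate_eq_rotate_by[of j] rotate_by_self)
    then have "j \<in> block (rotate j f) i" using tam_le_block_mono[OF tam_le_rotate i] by auto
    then have "rotate j f i - rotate i f i \<le> rotate j f j - rotate i f j" using 2 i by (auto simp: tam_le_def)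
    moreover have "i \<notin> block f j" using assms(2) by (auto simp: excursion_def)
    ultimately show False using j by (simp add: rotate_out rotate_in excursion_self)
  qed
qed

lemma left_step:
  assumes "left_type (Suc l) f h j"
  shows "tam_le (rotate j f) h" "slack f j 1"
proof -
  show "tam_le (rotate j f) h" using assms tam_le_rotate_by[of 1 "int (Suc l)" j f] by (simp add: left_type_def rotate_eq_rotate_by)
  show "slack f j 1" using assms slack_mono[of f j "int (Suc l)" 1] by (auto simp: left_type_def)
qed

lemma left_Suc:
  assumes "f \<in> paths" "left_type l (rotate j f) h j"
  shows "left_type (Suc l) f h j"
proof -
  have h: "j < n" "slack (rotate j f) j (int l)" "h = rotate_by j (int l) (rotate j f)" using assms by (auto simp: left_type_def)
  have e: "block (rotate j f) j = block f j" by (simp add: rotate_eq_rotate_by block_rotate_by excursion_self)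
  have "t \<notin> block f j" if "t < j" for t using that by (auto simp: excursion_def)
  then have "slack f j (int (Suc l))" using h(2) by (auto simp: slack_def rotate_out rotate_in excursion_self)
  moreover have "h = rotate_by j (int (Suc l)) f"
    unfolding h(3) rotate_by_def e by (auto simp: lower_def rotate_def)
  ultimately show ?thesis using assms(1) h(1) by (simp add: left_type_def)
qed

text \<open>For adjacent excursions, rotating the first one once and then the second one at least twice does not
give a linear interval, because one may also begin with the second excursion. After that rotation the
excursion of \<open>i\<close> swallows that of \<open>j\<close>, and \<open>h\<close> is still above since the second excursion has to drop
further anyway.\<close>
lemma rotate_second_first:
  assumes returns: "returns (alt f) i j" and lf: "left_type (Suc l) (rotate i f) h j" "l \<noteq> 0"
  shows "slack f j 1" "tam_le (rotate j f) h"
proof -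
  have lt: "i < j" using returns by (simp add: returns_def)
  have ei: "block f i = {i..<j}" using excursion_if_returns[OF returns] .
  have ej: "block (rotate i f) j = block f j" using block_rotate_later[OF lt] .
  have hs: "slack (rotate i f) j (int (Suc l))" "h = rotate_by j (int (Suc l)) (rotate i f)" using lf by (auto simp: left_type_def)
  have rr: "slack (rotate i f) j 2" using hs(1) lf(2) by (rule_tac slack_mono[of _ _ "int (Suc l)"]) auto
  have jo: "rotate i f j = f j" using ei by (auto simp: rotate_out)
  have "f t + 1 \<le> f j" if "t < j" for t using rr rotate_bounds(2)[of f t i] that jo by (force simp: slack_def)
  moreover have "1 \<le> f j" using rr jo by (auto simp: slack_def)
  ultimately show "slack f j 1" by (simp add: slack_def)
  let ?g = "rotate j f"
  have d: "?g t - h t = (if t \<in> block f j then int l else if t \<in> block f i then 1 else 0)" for t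
    using hs(2) ej ei by (auto simp: rotate_by_def lower_def rotate_def dest: excursion_le)
  have "?g q - h q \<le> ?g k - h k" if k: "q < n" "k \<in> block ?g q" for q k
  proof (cases "q \<in> block f j")
    case True
    then have "k \<in> block f j" using k(2) block_rotate_by[of q f j 1] excursion_trans by (auto simp: rotate_eq_rotate_by)
    then show ?thesis using True d by simp
  next
    case qj: False
    show ?thesis
    proof (cases "q \<in> block f i")
      case q: True
      have "k \<in> block f i \<or> k \<in> block f j"
      proof (rule ccontr)
        assume nk: "\<not> (k \<in> block f i \<or> k \<in> block f j)"
        then have "j < k" using ei excursion_le[OF k(2)] q excursion_self[of j "alt f"] by (cases "k = j") auto
        then obtain t where t: "j < t" "t \<le> k" "alt f t \<le> alt f j" "t \<notin> block f j"
          using nk excursion_exit by metis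
        have "q < t" using q ei t(1) by simp
        then have "alt ?g q < alt ?g t" using k(2) t(2) by (simp add: excursion_def)
        then have "alt f q < alt f t" using t(4) qj by (simp add: alt_def rotate_out)
        then show False using excursion_ge[OF q] t(3) returns by (simp add: returns_def)
      qed
      then show ?thesis using lf(2) d[of q] d[of k] qj q by auto
    next
      case False
      then show ?thesis using qj d by simp
    qed
  qed
  moreover have "h t \<le> ?g t" for t using d[of t] by (auto split: if_splits)
  ultimately show "tam_le ?g h" by (simp add: tam_le_def)
qed

text \<open>Rotate at the first difference \<open>i\<close> and apply the induction hypothesis to the rest, which begins with
a rotation at some \<open>j \<ge> i\<close>. If \<open>j = i\<close>, the rest must be a left interval: one east step has been put between
the excursion of \<open>i\<close> and whatever follows it. If \<open>j > i\<close>, the commutation lemma gives a second atom unless the two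
excursions are adjacent, and then the rest must be a right interval.\<close>
lemma linear_interval_classification:
  assumes "linear_interval (Suc l) f h"
  shows "\<exists>j. left_type (Suc l) f h j \<or> right_type l f h j"
  using assms
proof (induction l arbitrary: f)
  case 0
  have fh: "f \<in> paths" "h \<in> paths" "tam_le f h" using 0 by (auto simp: linear_interval_def)
  have "f \<noteq> h" using 0 by (rule linear_interval_Suc_neq)
  then obtain i where i: "h i < f i" "\<And>t. t < i \<Longrightarrow> h t = f t" using first_difference fh(3) by metis
  note m = rotate_at_first_difference[OF fh i]
  have p: "rotate i f \<in> paths" using rotate_paths fh m by auto
  have c: "linear_interval 0 (rotate i f) h" using linear_interval_tail[OF 0 i] .
  then have "h = rotate i f" by (simp add: linear_interval_0)
  then have "left_type (Suc 0) f h i" using fh m by (simp add: left_type_def rotate_eq_rotate_by)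
  then show ?case by blast
next
  case (Suc l)
  have fh: "f \<in> paths" "h \<in> paths" "tam_le f h" using Suc.prems by (auto simp: linear_interval_def)
  have "f \<noteq> h" using Suc.prems by (rule linear_interval_Suc_neq)
  then obtain i where i: "h i < f i" "\<And>t. t < i \<Longrightarrow> h t = f t" using first_difference fh(3) by metis
  note m = rotate_at_first_difference[OF fh i]
  have p: "rotate i f \<in> paths" using rotate_paths fh m by auto
  have c: "linear_interval (Suc l) (rotate i f) h" using linear_interval_tail[OF Suc.prems i] .
  then obtain j where j: "left_type (Suc l) (rotate i f) h j \<or> right_type l (rotate i f) h j" using Suc.IH by blast
  have jn: "j < n" and rj: "slack (rotate i f) j 1" and cj: "tam_le (rotate j (rotate i f)) h"
  proof -
    have "j < n \<and> slack (rotate i f) j 1 \<and> tam_le (rotate j (rotate i f)) h"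
    proof (cases "left_type (Suc l) (rotate i f) h j")
      case True
      then show ?thesis using left_step[OF True] by (auto simp: left_type_def)
    next
      case False
      then have r: "right_type l (rotate i f) h j" using j by simp
      show ?thesis
      proof (cases l)
        case 0
        then have lf: "left_type (Suc 0) (rotate i f) h j" using r right_0 by auto
        show ?thesis using left_step(1,2)[OF lf] lf by (simp add: left_type_def)
      next
        case (Suc l')
        then have r: "right_type (Suc l') (rotate i f) h j" using r by simp
        then obtain j' where j': "j < n" "slack (rotate i f) j 1" "right_type l' (rotate j (rotate i f)) h j'"
          using right_Suc_D by metis
        then have "tam_le (rotate j (rotate i f)) h" using right_type_linear by (auto simp: linear_interval_def)
        then show ?thesis using j' by simp
      qed
    qed
    then show "j < n" "slack (rotate i f) j 1" "tam_le (rotate j (rotate i f)) h" by auto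
  qed
  have ij: "i \<le> j"
  proof (rule ccontr)
    assume "\<not> i \<le> j"
    moreover have "h j \<le> rotate j (rotate i f) j" using cj by (simp add: tam_le_def)
    moreover have "rotate j (rotate i f) j = rotate i f j - 1" by (simp add: rotate_in excursion_self)
    ultimately show False using i(2)[of j] rotate_bounds(1)[of i f j] by simp
  qed
  show ?case
  proof (cases "j = i")
    case True
    show ?thesis
    proof (cases "left_type (Suc l) (rotate i f) h j")
      case True
      then show ?thesis using left_Suc[OF fh(1)] \<open>j = i\<close> by blast
    next
      case False
      then have "right_type l (rotate i f) h i" "l \<noteq> 0" using j True right_0 by (auto intro: gr0I)
      then obtain l' where "right_type (Suc l') (rotate i f) h i" by (metis not0_implies_Suc)
      \<comment> \<open>Rotating at \<open>i\<close> lifts the altitude at \<open>i\<close> but not at \<open>k\<close>, so \<open>k\<close> would have been in the excursion of \<open>i\<close>.\<close>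
      then obtain k where k: "returns (alt (rotate i f)) i k" using right_Suc_D by metis
      have e: "block (rotate i f) i = block f i" by (simp add: rotate_eq_rotate_by block_rotate_by excursion_self)
      have kn: "k \<notin> block f i" using excursion_if_returns[OF k] e by auto
      have ak: "alt f k = alt f i + 1" "i < k" using k kn by (auto simp: returns_def alt_def rotate_out rotate_in excursion_self)
      have "alt f i < alt f t" if "i < t" "t \<le> k" for t
      proof (cases "t = k")
        case False
        then have "t \<in> block f i" using that excursion_if_returns[OF k] e by auto
        then show ?thesis using that by (auto simp: excursion_def)
      qed (use ak in simp)
      then show ?thesis using kn ak by (auto simp: excursion_def)
    qed
  next
    case False
    then have lt: "i < j" using ij by simp
    show ?thesis
    proof (cases "returns (alt f) i j")
      case False
      have r: "slack f j 1" using slack_before_rotate[OF fh(1) lt rj False] .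
      have "tam_le (rotate j f) (rotate j (rotate i f))" using tam_le_rotate rotate_commute[OF lt False] by metis
      then have "tam_le (rotate j f) h" using cj tam_le_trans by blast
      then show ?thesis using linear_interval_unique_atom[OF Suc.prems lt jn m(2) r m(3)] by blast
    next
      case True
      show ?thesis
      proof (cases "right_type l (rotate i f) h j")
        case r: True
        then show ?thesis using right_Suc[OF fh(1) m(2) True r] by blast
      next
        case nr: False
        then have lf: "left_type (Suc l) (rotate i f) h j" "l \<noteq> 0" using j right_0 by (auto intro: gr0I)
        note rs = rotate_second_first[OF True lf]
        show ?thesis using linear_interval_unique_atom[OF Suc.prems lt jn m(2) rs(1) m(3) rs(2)] by blast
      qed
    qed
  qed
qed


section \<open>Counting the two kinds\<close>

text \<open>A path with a valley in front of north step \<open>j\<close>, followed by \<open>r\<close> adjacent excursions up to north step \<open>k\<close>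
and then by at least \<open>q + 1\<close> consecutive north steps. For \<open>r = 0\<close> this means \<open>k = j\<close>, and altitudes
no longer enter.\<close>
definition return_chains :: "nat \<Rightarrow> nat \<Rightarrow> ((nat \<Rightarrow> int) \<times> nat \<times> nat) set" where
  "return_chains r q = {(f, j, k). f \<in> paths \<and> slack f j 1 \<and> (returns (alt f) ^^ r) j k \<and> k + q < n \<and> f (k + q) = f k}"

text \<open>In a word that begins with \<open>w + 1\<close> north steps from \<open>k\<close> on, north step \<open>t + w\<close> is measured with the
increments that belong to position \<open>t\<close>, where it will stand once \<open>w\<close> north steps have been moved behind it. The
index \<open>k'\<close> marks the first descent to the starting altitude under this measure.\<close>
definition first_fit :: "nat \<Rightarrow> (nat \<Rightarrow> int) \<Rightarrow> nat \<Rightarrow> nat \<Rightarrow> bool" where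
  "first_fit w g k k' \<longleftrightarrow> k < k' \<and> k' + w \<le> n \<and> s k' - s k \<le> g (k' + w) - g k \<and>
     (\<forall>t. k < t \<and> t < k' \<longrightarrow> g (t + w) - g k < s t - s k)"

text \<open>The trade \<open>N N\<^sup>w B' C' \<mapsto> N B' N\<^sup>w C'\<close> and its inverse \<open>delay\<close>, where \<open>N\<close> is north step \<open>k\<close>, the steps of
\<open>B'\<close> are shifted by \<open>w\<close>, and the block \<open>N\<^sup>w\<close> is placed at the point where the excursion \<open>N B'\<close> ends.\<close>
definition advance :: "nat \<Rightarrow> nat \<Rightarrow> nat \<Rightarrow> (nat \<Rightarrow> int) \<Rightarrow> nat \<Rightarrow> int" where
  "advance w k k' g = (\<lambda>t. if t \<le> k then g t else if t < k' then g (t + w)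
     else if t < k' + w then g k + (s k' - s k) else g t)"

definition delay :: "nat \<Rightarrow> nat \<Rightarrow> nat \<Rightarrow> (nat \<Rightarrow> int) \<Rightarrow> nat \<Rightarrow> int" where
  "delay w k k' f = (\<lambda>t. if t \<le> k then f t else if t \<le> k + w then f k
     else if t < k' + w then f (t - w) else f t)"

lemma c_mono: "t \<le> u \<Longrightarrow> c t \<le> c u"
  using monoD[OF s_mono, of t u] monoD[OF cs_mono, of t u] by simp

text \<open>The descent takes place at the latest at the end of the path, because the sum of the increments
from \<open>k\<close> on does not exceed the number of east steps still to come.\<close>
lemma first_fit_ex:
  assumes "g \<in> paths" "k + w < n"
  shows "\<exists>k'. first_fit w g k k'"
proof -
  \<comment> \<open>The index \<open>n - w\<close> corresponds to the end of the path, since \<open>n\<close> is the index of the end point.\<close>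
  let ?P = "\<lambda>k'. k < k' \<and> s k' - s k \<le> g (k' + w) - g k"
  have "s (n - w) - s k \<le> c n - c k"
    using monoD[OF s_mono, of "n - w" n] monoD[OF cs_mono, of k n] assms(2) by simp
  also have "\<dots> \<le> g (n - w + w) - g k" using assms by (simp add: paths_def)
  finally have P: "?P (n - w)" using assms(2) by simp
  have l: "?P (LEAST k'. ?P k')" using P by (rule LeastI)
  have "(LEAST k'. ?P k') \<le> n - w" using P by (rule Least_le)
  then have le: "(LEAST k'. ?P k') + w \<le> n" using assms(2) by simp
  have "g (t + w) - g k < s t - s k" if "k < t" "t < (LEAST k'. ?P k')" for t
    using not_less_Least[OF that(2)] that(1) by simp
  then show ?thesis using l le unfolding first_fit_def by blast
qed

lemma first_fit_unique: "first_fit w g k k' \<Longrightarrow> first_fit w g k k'' \<Longrightarrow> k' = k''"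
  unfolding first_fit_def by (metis linorder_neqE_nat not_less)

text \<open>The new path stays weakly above \<open>\<nu>\<close>: up to \<open>k'\<close> it has made at most \<open>s t - s k\<close> east steps
since \<open>k\<close>, and \<open>c\<close> grows at least as fast as \<open>s\<close>.\<close>
lemma advance_paths:
  assumes "g \<in> paths" "first_fit w g k k'"
  shows "advance w k k' g \<in> paths"
proof -
  have m: "mono g" using assms by (simp add: paths_def)
  \<comment> \<open>The number of east steps at the point where the new excursion ends.\<close>
  define v where "v = g k + (s k' - s k)"
  have ff: "k < k'" "k' + w \<le> n" "v \<le> g (k' + w)" "\<And>t. k < t \<Longrightarrow> t < k' \<Longrightarrow> g (t + w) < g k + (s t - s k)"
    using assms(2) by (auto simp: first_fit_def v_def algebra_simps)
  have gv: "g k \<le> v" using monoD[OF s_mono, of k k'] ff(1) by (simp add: v_def)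
  have lt: "g (t + w) \<le> v" if "k < t" "t < k'" for t
    using ff(4)[OF that] monoD[OF s_mono, of t k'] that by (simp add: v_def)
  have "advance w k k' g t \<le> advance w k k' g (Suc t)" for t
  proof -
    have "g t \<le> g (Suc t)" "g t \<le> g (Suc t + w)" "g (t + w) \<le> g (Suc t + w)"
      by (auto intro: monoD[OF m])
    moreover have "v \<le> g (Suc t)" if "k' + w \<le> Suc t" using ff(3) monoD[OF m that] by simp
    moreover have "g t \<le> v" if "t \<le> k" using gv monoD[OF m that] by simp
    ultimately show ?thesis using lt[of t] ff(1) unfolding advance_def v_def[symmetric] by auto
  qed
  moreover have "advance w k k' g t \<le> c t" for t
  proof -
    have g: "g u \<le> c u" for u using assms(1) by (simp add: paths_def)
    have "g k + (s u - s k) \<le> c u" if "k < u" for u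
      using g[of k] monoD[OF cs_mono, of k u] that by simp
    then show ?thesis using g[of t] ff(1) ff(4)[of t] c_mono[of k' t]
      unfolding advance_def by (smt (verit) not_less)
  qed
  moreover have "advance w k k' g t = c t" if "n \<le> t" for t
    using that ff(1,2) assms(1) by (simp add: advance_def paths_def)
  moreover have "0 \<le> advance w k k' g 0" using assms(1) by (simp add: advance_def paths_def)
  ultimately show ?thesis by (simp add: paths_def mono_iff_le_Suc)
qed

text \<open>Moving north steps to the front only decreases the entries of the sequence.\<close>
lemma delay_paths:
  assumes "f \<in> paths" "k < k'" "k' + w \<le> n"
  shows "delay w k k' f \<in> paths"
proof -
  have m: "mono f" using assms by (simp add: paths_def)
  have "delay w k k' f t \<le> delay w k k' f (Suc t)" for t
  proof -
    have "f t \<le> f (Suc t)" "f (t - w) \<le> f (Suc t)" "f (t - w) \<le> f (Suc t - w)"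
      by (auto intro!: monoD[OF m])
    moreover have "f k \<le> f (Suc t)" "f k \<le> f (Suc t - w)" if "k + w \<le> t"
      using that by (auto intro!: monoD[OF m])
    moreover have "f t \<le> f k" if "t \<le> k" using monoD[OF m that] .
    ultimately show ?thesis using assms(2) unfolding delay_def by auto
  qed
  moreover have "delay w k k' f t \<le> c t" for t
  proof -
    have "delay w k k' f t \<le> f t" unfolding delay_def by (auto intro!: monoD[OF m])
    also have "f t \<le> c t" using assms by (simp add: paths_def)
    finally show ?thesis .
  qed
  moreover have "delay w k k' f t = c t" if "n \<le> t" for t
    using that assms by (simp add: delay_def paths_def)
  moreover have "0 \<le> delay w k k' f 0" using assms(1) by (simp add: delay_def paths_def)
  ultimately show ?thesis by (simp add: paths_def mono_iff_le_Suc)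
qed

text \<open>The trade at \<open>k\<close> keeps the entries up to \<open>k\<close>, hence also the excursions before \<open>k\<close>.\<close>
lemma prefix_cong:
  assumes "slack f j 1" "(returns (alt f) ^^ r) j k" "\<And>t. t \<le> k \<Longrightarrow> g t = f t"
  shows "slack g j 1" "(returns (alt g) ^^ r) j k"
proof -
  have "j \<le> k" using assms(2) by (rule returns_pow_le)
  then show "slack g j 1" using assms(1,3) by (simp add: slack_def)
  show "(returns (alt g) ^^ r) j k"
    using returns_pow_cong[OF assms(2), of "alt g"] assms(3) by (simp add: alt_def)
qed

lemma const_between:
  assumes "f \<in> paths" "f (k + q) = f k" "k \<le> t" "t \<le> k + q"
  shows "f t = f k"
  using assms monoD[of f k t] monoD[of f t "k + q"] by (simp add: paths_def)

text \<open>One trade. Both sides are refined by the index that the projection forgets: the place \<open>k'\<close> where the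
excursion will end on one side, the place \<open>k\<close> where it starts on the other. Each is determined by
the rest of the data.\<close>
lemma card_return_chains_Suc: "card (return_chains (Suc r) q) = card (return_chains r (Suc q))"
proof -
  let ?w = "Suc q"
  define A where "A = {(g, j, k, k'). (g, j, k) \<in> return_chains r ?w \<and> first_fit ?w g k k'}"
  define B where "B = {(f, j, k, k'). f \<in> paths \<and> slack f j 1 \<and> (returns (alt f) ^^ r) j k \<and>
    returns (alt f) k k' \<and> k' + q < n \<and> f (k' + q) = f k'}"
  let ?F = "\<lambda>(g, j, k, k'). (advance ?w k k' g, j, k, k')"
  let ?G = "\<lambda>(f, j, k, k'). (delay ?w k k' f, j, k, k')"
  have "bij_betw ?F A B"
  proof (rule bij_betw_byWitness[where f' = ?G])
    show "\<forall>x\<in>A. ?G (?F x) = x"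
    proof (rule ballI)
      fix x assume xA: "x \<in> A"
      obtain g j k k' where x: "x = (g, j, k, k')" by (rule prod_cases4)
      have "(g, j, k, k') \<in> A" using xA x by simp
      then have a: "g \<in> paths" "g (k + ?w) = g k" "first_fit ?w g k k'" by (auto simp: A_def return_chains_def)
      have "k < k'" using a(3) by (simp add: first_fit_def)
      then have "delay ?w k k' (advance ?w k k' g) t = g t" for t
        using const_between[OF a(1,2), of t] by (auto simp: delay_def advance_def)
      then have "delay ?w k k' (advance ?w k k' g) = g" by (rule ext)
      then show "?G (?F x) = x" using x by simp
    qed
    show "\<forall>x\<in>B. ?F (?G x) = x"
    proof (rule ballI)
      fix x assume xA: "x \<in> B"
      obtain f j k k' where x: "x = (f, j, k, k')" by (rule prod_cases4)
      have "(f, j, k, k') \<in> B" using xA x by simp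
      then have a: "f \<in> paths" "f (k' + q) = f k'" "returns (alt f) k k'" by (auto simp: B_def)
      have k: "k < k'" "f k + (s k' - s k) = f k'" using a(3) by (auto simp: returns_def alt_def)
      have "advance ?w k k' (delay ?w k k' f) t = f t" for t
        using k const_between[OF a(1,2), of t] by (auto simp: delay_def advance_def)
      then have "advance ?w k k' (delay ?w k k' f) = f" by (rule ext)
      then show "?F (?G x) = x" using x by simp
    qed
    show "?F ` A \<subseteq> B"
    proof (rule image_subsetI)
      fix x assume xA: "x \<in> A"
      obtain g j k k' where x: "x = (g, j, k, k')" by (rule prod_cases4)
      have "(g, j, k, k') \<in> A" using xA x by simp
      then have a: "g \<in> paths" "slack g j 1" "(returns (alt g) ^^ r) j k" "k + ?w < n" "first_fit ?w g k k'"
        by (auto simp: A_def return_chains_def)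
      have k: "k < k'" "k' + q < n" "\<And>t. k < t \<Longrightarrow> t < k' \<Longrightarrow> g (t + ?w) - g k < s t - s k"
        using a(5) by (auto simp: first_fit_def)
      let ?f = "advance ?w k k' g"
      have "alt ?f k < alt ?f t" if "k < t" "t < k'" for t
        using k(3)[OF that] that by (simp add: alt_def advance_def)
      then have "returns (alt ?f) k k'" using k(1) by (simp add: returns_def alt_def advance_def)
      moreover have "?f (k' + q) = ?f k'" using k(1) by (simp add: advance_def)
      moreover have "slack ?f j 1" "(returns (alt ?f) ^^ r) j k"
        using prefix_cong[OF a(2,3), of ?f] by (auto simp: advance_def)
      ultimately show "?F x \<in> B" using advance_paths[OF a(1,5)] k(2) a(2) x by (simp add: B_def)
    qed
    show "?G ` B \<subseteq> A"
    proof (rule image_subsetI)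
      fix x assume xA: "x \<in> B"
      obtain f j k k' where x: "x = (f, j, k, k')" by (rule prod_cases4)
      have "(f, j, k, k') \<in> B" using xA x by simp
      then have a: "f \<in> paths" "slack f j 1" "(returns (alt f) ^^ r) j k" "returns (alt f) k k'" "k' + q < n"
        by (auto simp: B_def)
      have k: "k < k'" "f k + (s k' - s k) = f k'" "\<And>t. k < t \<Longrightarrow> t < k' \<Longrightarrow> f t - f k < s t - s k"
        using a(4) by (auto simp: returns_def alt_def)
      let ?g = "delay ?w k k' f"
      have "f k' \<le> f (k' + ?w)" using a(1) by (auto simp: paths_def intro: monoD)
      then have "first_fit ?w ?g k k'" using k a(5) by (auto simp: first_fit_def delay_def)
      moreover have "?g (k + ?w) = ?g k" by (simp add: delay_def)
      moreover have "slack ?g j 1" "(returns (alt ?g) ^^ r) j k"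
        using prefix_cong[OF a(2,3), of ?g] by (auto simp: delay_def)
      ultimately show "?G x \<in> A" unfolding x using delay_paths[OF a(1) k(1), of ?w] a(5) k(1)
        by (simp add: A_def return_chains_def)
    qed
  qed
  then have "card A = card B" by (rule bij_betw_same_card)
  moreover have "bij_betw (\<lambda>(g, j, k, k'). (g, j, k)) A (return_chains r ?w)"
  proof (rule bij_betw_imageI)
    show "inj_on (\<lambda>(g, j, k, k'). (g, j, k)) A"
      by (auto simp: inj_on_def A_def intro: first_fit_unique)
    show "(\<lambda>(g, j, k, k'). (g, j, k)) ` A = return_chains r ?w"
    proof (intro equalityI subsetI)
      fix x assume x: "x \<in> return_chains r ?w"
      then obtain g j k where gjk: "x = (g, j, k)" "g \<in> paths" "k + ?w < n" by (auto simp: return_chains_def)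
      then obtain k' where "first_fit ?w g k k'" using first_fit_ex by blast
      then have "(g, j, k, k') \<in> A" using x gjk(1) by (simp add: A_def)
      then show "x \<in> (\<lambda>(g, j, k, k'). (g, j, k)) ` A" using gjk(1) by force
    qed (auto simp: A_def)
  qed
  moreover have "bij_betw (\<lambda>(f, j, k, k'). (f, j, k')) B (return_chains (Suc r) q)"
  proof (rule bij_betw_imageI)
    show "inj_on (\<lambda>(f, j, k, k'). (f, j, k')) B"
      by (auto simp: inj_on_def B_def intro: returns_pow_unique)
    show "(\<lambda>(f, j, k, k'). (f, j, k')) ` B = return_chains (Suc r) q"
    proof (intro equalityI subsetI)
      fix x assume "x \<in> return_chains (Suc r) q"
      then obtain f j k' where x: "x = (f, j, k')" and a: "f \<in> paths" "slack f j 1"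
        "(returns (alt f) ^^ Suc r) j k'" "k' + q < n" "f (k' + q) = f k'" by (auto simp: return_chains_def)
      obtain k where "(returns (alt f) ^^ r) j k" "returns (alt f) k k'" using a(3) by (rule relpowp_Suc_E)
      then have "(f, j, k, k') \<in> B" using a by (simp add: B_def)
      then show "x \<in> (\<lambda>(f, j, k, k'). (f, j, k')) ` B" using x by force
    qed (auto simp: B_def return_chains_def)
  qed
  ultimately show ?thesis using bij_betw_same_card by metis
qed

lemma card_return_chains: "card (return_chains m 0) = card (return_chains 0 m)"
proof -
  have "card (return_chains (m - r) r) = card (return_chains m 0)" if "r \<le> m" for r
    using that
  proof (induction r)
    case (Suc r)
    then have "m - r = Suc (m - Suc r)" by simp
    then show ?case using Suc card_return_chains_Suc[of "m - Suc r" r] by simp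
  qed simp
  from this[of m] show ?thesis by simp
qed

lemma left_first: "left_type (Suc l) f h j \<Longrightarrow> h j < f j \<and> (\<forall>t<j. h t = f t)"
  by (auto simp: left_type_def rotate_by_self rotate_by_out excursion_def)

lemma right_first: "right_type m f h j \<Longrightarrow> h j < f j \<and> (\<forall>t<j. h t = f t)"
  by (auto simp: right_type_def lower_def excursion_def dest!: returns_pow_le)

lemma first_unique:
  fixes f h :: "nat \<Rightarrow> int"
  shows "h j < f j \<and> (\<forall>t<j. h t = f t) \<Longrightarrow> h i < f i \<and> (\<forall>t<i. h t = f t) \<Longrightarrow> j = i"
  by (metis less_irrefl linorder_neqE_nat)

text \<open>The index \<open>j\<close> can be read off from an interval as the first place where its ends differ.\<close>
lemma card_left:
  "card {(f, h). \<exists>j. left_type (Suc l) f h j} = card {(f, j). f \<in> paths \<and> j < n \<and> slack f j (int (Suc l))}"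
proof (rule bij_betw_same_card[symmetric])
  let ?F = "\<lambda>(f, j). (f, rotate_by j (int (Suc l)) f)"
  let ?A = "{(f, j). f \<in> paths \<and> j < n \<and> slack f j (int (Suc l))}"
  have L: "(f, j) \<in> ?A \<Longrightarrow> left_type (Suc l) f (rotate_by j (int (Suc l)) f) j" for f j by (simp add: left_type_def)
  show "bij_betw ?F ?A {(f, h). \<exists>j. left_type (Suc l) f h j}"
  proof (rule bij_betw_imageI)
    show "inj_on ?F ?A"
    proof (rule inj_onI)
      fix x y assume xy: "x \<in> ?A" "y \<in> ?A" "?F x = ?F y"
      obtain f i where x: "x = (f, i)" by (cases x)
      obtain j where y: "y = (f, j)" using xy(3) x by (cases y) auto
      have eq: "rotate_by i (int (Suc l)) f = rotate_by j (int (Suc l)) f" using xy(3) x y by simp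
      have "i = j" using left_first[OF L[OF xy(1)[unfolded x]]] left_first[OF L[OF xy(2)[unfolded y]]]
        unfolding eq by (rule first_unique)
      then show "x = y" using x y by simp
    qed
    show "?F ` ?A = {(f, h). \<exists>j. left_type (Suc l) f h j}"
      by (auto simp: left_type_def image_def)
  qed
qed

lemma card_right: "card {(f, h). \<exists>j. right_type m f h j} = card (return_chains m 0)"
proof (rule bij_betw_same_card[symmetric])
  let ?F = "\<lambda>(f, j, k). (f, lower f ({j..<k} \<union> block f k) 1)"
  have R: "(f, j, k) \<in> return_chains m 0 \<Longrightarrow> right_type m f (lower f ({j..<k} \<union> block f k) 1) j" for f j k
    by (auto simp: right_type_def return_chains_def)
  show "bij_betw ?F (return_chains m 0) {(f, h). \<exists>j. right_type m f h j}"
  proof (rule bij_betw_imageI)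
    show "inj_on ?F (return_chains m 0)"
    proof (rule inj_onI)
      fix x y assume xy: "x \<in> return_chains m 0" "y \<in> return_chains m 0" "?F x = ?F y"
      obtain f i k where x: "x = (f, i, k)" by (cases x)
      obtain j k' where y: "y = (f, j, k')" using xy(3) x by (cases y) auto
      have eq: "lower f ({i..<k} \<union> block f k) 1 = lower f ({j..<k'} \<union> block f k') 1" using xy(3) x y by simp
      have "i = j" using right_first[OF R[OF xy(1)[unfolded x]]] right_first[OF R[OF xy(2)[unfolded y]]]
        unfolding eq by (rule first_unique)
      moreover have "k = k'" using calculation xy(1,2) x y returns_pow_unique by (auto simp: return_chains_def)
      ultimately show "x = y" using x y by simp
    qed
    show "?F ` return_chains m 0 = {(f, h). \<exists>j. right_type m f h j}"
    proof (intro equalityI subsetI)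
      fix x assume "x \<in> {(f, h). \<exists>j. right_type m f h j}"
      then obtain f h j where x: "x = (f, h)" "right_type m f h j" by auto
      then obtain k where "(f, j, k) \<in> return_chains m 0" "h = lower f ({j..<k} \<union> block f k) 1"
        by (auto simp: right_type_def return_chains_def)
      then show "x \<in> ?F ` return_chains m 0" using x(1) by force
    qed (use R in auto)
  qed
qed

lemma card_linear_interval_0: "card {(f, h). linear_interval 0 f h} = card paths"
proof -
  have "{(f, h). linear_interval 0 f h} = (\<lambda>f. (f, f)) ` paths" by (auto simp: linear_interval_0)
  then show ?thesis by (simp add: card_image inj_on_def)
qed

lemma linear_interval_iff: "linear_interval (Suc l) f h \<longleftrightarrow> (\<exists>j. left_type (Suc l) f h j) \<or> (\<exists>j. right_type l f h j)"
  using linear_interval_classification left_type_linear right_type_linear by blast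

lemma card_linear_interval_1:
  "card {(f, h). linear_interval (Suc 0) f h} = card {(f, j). f \<in> paths \<and> j < n \<and> slack f j (int (Suc 0))}"
proof -
  have "{(f, h). linear_interval (Suc 0) f h} = {(f, h). \<exists>j. left_type (Suc 0) f h j}"
    using right_0 by (auto simp: linear_interval_iff)
  then show ?thesis using card_left[of 0] by simp
qed

text \<open>From length 2 on the two kinds are disjoint: the largest drop is the length in a left interval but
1 in a right interval.\<close>
lemma card_linear_interval_Suc_Suc:
  assumes "finite paths"
  shows "card {(f, h). linear_interval (Suc (Suc l)) f h} =
     card {(f, j). f \<in> paths \<and> j < n \<and> slack f j (int (Suc (Suc l)))} + card (return_chains 0 (Suc l))"
proof -
  let ?L = "{(f, h). \<exists>j. left_type (Suc (Suc l)) f h j}" and ?R = "{(f, h). \<exists>j. right_type (Suc l) f h j}"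
  have un: "{(f, h). linear_interval (Suc (Suc l)) f h} = ?L \<union> ?R" by (auto simp: linear_interval_iff)
  have "{(f, h). linear_interval (Suc (Suc l)) f h} \<subseteq> paths \<times> paths" by (auto simp: linear_interval_def)
  then have fin: "finite (?L \<union> ?R)" using un assms finite_subset by fastforce
  have "?L \<inter> ?R = {}"
  proof -
    have False if lr: "left_type (Suc (Suc l)) f h i" "right_type (Suc l) f h j" for f h i j
    proof -
      have "f i - h i \<ge> 2" using lr(1) by (simp add: left_type_def rotate_by_self)
      moreover have "f i - h i \<le> 1" using lr(2) by (auto simp: right_type_def lower_def)
      ultimately show False by simp
    qed
    then show ?thesis by auto
  qed
  then have "card {(f, h). linear_interval (Suc (Suc l)) f h} = card ?L + card ?R"
    unfolding un using fin by (intro card_Un_disjoint) auto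
  then show ?thesis using card_left[of "Suc l"] card_right[of "Suc l"] card_return_chains[of "Suc l"] by simp
qed

end

section \<open>Linear intervals under an isomorphism of posets\<close>

text \<open>In a partial order only totality is a condition on an interval.\<close>
lemma linear_intervals_iff:
  assumes "\<forall>x y. (x, y) \<in> r \<longrightarrow> (x, x) \<in> r \<and> (y, y) \<in> r" "trans r" "antisym r"
  shows "(P, Q) \<in> linear_intervals r l \<longleftrightarrow> (P, Q) \<in> r \<and>
    (\<forall>R\<in>interval r P Q. \<forall>S\<in>interval r P Q. (R, S) \<in> r \<or> (S, R) \<in> r) \<and> card (interval r P Q) = l + 1"
proof -
  let ?I = "interval r P Q"
  have refl: "(R, R) \<in> r" if "R \<in> ?I" for R using that assms(1) by (auto simp: interval_def)
  have "refl_on ?I (Restr r ?I)" using refl by (auto simp: refl_on_def)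
  moreover have "trans (Restr r ?I)" using assms(2) by (rule trans_Restr)
  moreover have "antisym (Restr r ?I)" using assms(3) by (rule antisym_Restr)
  moreover have "total_on ?I (Restr r ?I) \<longleftrightarrow> (\<forall>R\<in>?I. \<forall>S\<in>?I. (R, S) \<in> r \<or> (S, R) \<in> r)"
  proof
    assume t: "total_on ?I (Restr r ?I)"
    show "\<forall>R\<in>?I. \<forall>S\<in>?I. (R, S) \<in> r \<or> (S, R) \<in> r"
    proof (intro ballI)
      fix R S assume "R \<in> ?I" "S \<in> ?I"
      then show "(R, S) \<in> r \<or> (S, R) \<in> r" using t refl by (cases "R = S") (auto simp: total_on_def)
    qed
  qed (simp add: total_on_def)
  ultimately show ?thesis
    by (auto simp: linear_intervals_def linear_order_on_def partial_order_on_def preorder_on_def)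
qed

lemma card_linear_intervals_transport:
  assumes h: "bij_betw h A B" and sub: "r \<subseteq> A \<times> A" "r' \<subseteq> B \<times> B"
    and iff: "\<And>x y. x \<in> A \<Longrightarrow> y \<in> A \<Longrightarrow> (x, y) \<in> r \<longleftrightarrow> (h x, h y) \<in> r'"
    and po: "\<And>x. x \<in> B \<Longrightarrow> (x, x) \<in> r'" "trans r'" "antisym r'"
  shows "card (linear_intervals r l) = card (linear_intervals r' l)"
proof -
  have inj: "inj_on h A" and im: "h ` A = B" using h by (auto simp: bij_betw_def)
  have rA: "x \<in> A" "y \<in> A" "(h x, h y) \<in> r'" if "(x, y) \<in> r" for x y using that sub(1) iff by auto
  have hB: "h x \<in> B" if "x \<in> A" for x using that im by auto
  have rr: "(x, x) \<in> r" if "x \<in> A" for x using that iff[of x x] po(1)[of "h x"] hB[of x] by simp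
  have po1: "\<forall>x y. (x, y) \<in> r \<longrightarrow> (x, x) \<in> r \<and> (y, y) \<in> r" using rA(1,2) rr by simp
  have po2: "trans r"
  proof (rule transI)
    fix x y z assume xy: "(x, y) \<in> r" and yz: "(y, z) \<in> r"
    have "(h x, h z) \<in> r'" using transD[OF po(2) rA(3)[OF xy] rA(3)[OF yz]] .
    then show "(x, z) \<in> r" using iff[of x z] rA(1)[OF xy] rA(2)[OF yz] by simp
  qed
  have po3: "antisym r"
  proof (rule antisymI)
    fix x y assume xy: "(x, y) \<in> r" and yx: "(y, x) \<in> r"
    have "h x = h y" using antisymD[OF po(3) rA(3)[OF xy] rA(3)[OF yx]] .
    then show "x = y" using inj_onD[OF inj _ rA(1,2)[OF xy]] by simp
  qed
  have po1': "\<forall>u v. (u, v) \<in> r' \<longrightarrow> (u, u) \<in> r' \<and> (v, v) \<in> r'" using po(1) sub(2) by auto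
  have int: "interval r' (h x) (h y) = h ` interval r x y" and intA: "interval r x y \<subseteq> A"
    if "x \<in> A" "y \<in> A" for x y
  proof -
    show "interval r x y \<subseteq> A" using sub(1) by (auto simp: interval_def)
    show "interval r' (h x) (h y) = h ` interval r x y"
    proof (intro equalityI subsetI)
      fix z assume z: "z \<in> interval r' (h x) (h y)"
      then have "z \<in> B" using sub(2) by (auto simp: interval_def)
      then obtain w where "w \<in> A" "z = h w" using im by auto
      then show "z \<in> h ` interval r x y" using z that iff by (auto simp: interval_def)
    next
      fix z assume "z \<in> h ` interval r x y"
      then show "z \<in> interval r' (h x) (h y)" using rA by (auto simp: interval_def)
    qed
  qed
  have key: "(x, y) \<in> linear_intervals r l \<longleftrightarrow> (h x, h y) \<in> linear_intervals r' l" if xy: "x \<in> A" "y \<in> A" for x y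
  proof -
    have c: "card (interval r' (h x) (h y)) = card (interval r x y)"
      unfolding int[OF xy] using intA[OF xy] inj by (intro card_image) (rule inj_on_subset)
    have t: "(\<forall>R\<in>interval r' (h x) (h y). \<forall>S\<in>interval r' (h x) (h y). (R, S) \<in> r' \<or> (S, R) \<in> r')
       \<longleftrightarrow> (\<forall>R\<in>interval r x y. \<forall>S\<in>interval r x y. (R, S) \<in> r \<or> (S, R) \<in> r)"
      unfolding int[OF xy] ball_simps(9) using intA[OF xy] iff by blast
    show ?thesis unfolding linear_intervals_iff[OF po1 po2 po3] linear_intervals_iff[OF po1' po(2,3)] c t
      using iff[OF xy] by simp
  qed
  have "bij_betw (map_prod h h) (linear_intervals r l) (linear_intervals r' l)"
  proof (rule bij_betw_imageI)
    have s: "linear_intervals r l \<subseteq> A \<times> A" using sub(1) by (auto simp: linear_intervals_def)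
    then show "inj_on (map_prod h h) (linear_intervals r l)"
      using map_prod_inj_on[OF inj inj] by (rule_tac inj_on_subset)
    show "map_prod h h ` linear_intervals r l = linear_intervals r' l"
    proof (intro equalityI subsetI)
      fix z assume z: "z \<in> linear_intervals r' l"
      then have "z \<in> B \<times> B" using sub(2) by (auto simp: linear_intervals_def)
      then obtain x y where "x \<in> A" "y \<in> A" "z = (h x, h y)" using im by auto
      then show "z \<in> map_prod h h ` linear_intervals r l" using key z by force
    next
      fix z assume "z \<in> map_prod h h ` linear_intervals r l"
      then show "z \<in> linear_intervals r' l" using s key by auto
    qed
  qed
  then show ?thesis by (rule bij_betw_same_card)
qed

context nu_alt
begin

lemma linear_intervals_tam: "linear_intervals tam l = {(f, h). linear_interval l f h}"
proof -
  have 1: "\<forall>x y. (x, y) \<in> tam \<longrightarrow> (x, x) \<in> tam \<and> (y, y) \<in> tam" by (simp add: tam_iff tam_le_refl)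
  have 2: "trans tam" by (rule transI) (auto simp: tam_iff intro: tam_le_trans)
  have 3: "antisym tam" by (rule antisymI) (auto simp: tam_iff intro: tam_le_antisym)
  have m: "R \<in> paths" if "R \<in> interval tam f h" for R f h using that by (auto simp: interval_def tam_iff)
  have "(f, h) \<in> linear_intervals tam l \<longleftrightarrow> linear_interval l f h" for f h
  proof -
    let ?I = "interval tam f h"
    have "(\<forall>R\<in>?I. \<forall>S\<in>?I. (R, S) \<in> tam \<or> (S, R) \<in> tam) \<longleftrightarrow>
       (\<forall>R\<in>?I. \<forall>S\<in>?I. tam_le R S \<or> tam_le S R)"
      by (intro ball_cong refl) (simp add: tam_iff m)
    then show ?thesis unfolding linear_intervals_iff[OF 1 2 3] linear_interval_def tam_iff[of f h] by simp
  qed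
  then show ?thesis by auto
qed

end

section \<open>Words and their run lengths\<close>

text \<open>The inverse of \<open>path_word\<close>: the run lengths of the east steps of a word.\<close>
fun word_path :: "step list \<Rightarrow> nat list" where
  "word_path [] = [0]"
| "word_path (East # w) = Suc (hd (word_path w)) # tl (word_path w)"
| "word_path (North # w) = 0 # word_path w"

lemma path_word_simps:
  "path_word [0] = []" "path_word (Suc k # ks) = East # path_word (k # ks)"
  "path_word (0 # k # ks) = North # path_word (k # ks)"
  by (simp_all add: path_word_def)

lemma word_path_not_Nil: "word_path w \<noteq> []"
  by (induction w rule: word_path.induct) auto

lemma path_word_word_path: "path_word (word_path w) = w"
proof (induction w rule: word_path.induct)
  case (2 w)
  then show ?case using word_path_not_Nil[of w] by (cases "word_path w") (simp_all add: path_word_simps)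
next
  case (3 w)
  then show ?case using word_path_not_Nil[of w] by (cases "word_path w") (simp_all add: path_word_simps)
qed (simp add: path_word_simps)

lemma word_path_path_word: "word_path (path_word (k # ks)) = k # ks"
proof (induction ks arbitrary: k)
  case Nil
  show ?case by (induction k) (simp_all add: path_word_simps)
next
  case (Cons a ks)
  show ?case by (induction k) (simp_all add: path_word_simps Cons)
qed

lemma path_word_inj:
  assumes "path_word \<mu> = path_word \<mu>'" "\<mu> \<noteq> []" "\<mu>' \<noteq> []"
  shows "\<mu> = \<mu>'"
  using assms word_path_path_word by (metis list.exhaust)

text \<open>Cutting a word at a lattice point splits one run of east steps. With \<open>path_word_snocE\<close> and
\<open>path_word_ConsE\<close> this translates every factorisation of a word into one of the list of run lengths.\<close>
lemma path_word_append: "path_word (us @ [a]) @ path_word (b # vs) = path_word (us @ (a + b) # vs)"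
  by (cases us) (simp_all add: path_word_def replicate_add)

lemma path_word_snocE: obtains us a where "w = path_word (us @ [a])"
  using path_word_word_path word_path_not_Nil by (metis rev_exhaust)

lemma path_word_ConsE: obtains b vs where "w = path_word (b # vs)"
  using path_word_word_path word_path_not_Nil by (metis list.exhaust)

lemma count_path_word:
  "count_list (path_word (k # ks)) North = length ks"
  "count_list (path_word (k # ks)) East = k + sum_list ks"
proof -
  have "count_list (path_word (k # ks)) North = length ks \<and> count_list (path_word (k # ks)) East = k + sum_list ks"
  proof (induction ks arbitrary: k)
    case Nil
    show ?case by (induction k) (simp_all add: path_word_simps)
  next
    case (Cons a ks)
    show ?case by (induction k) (simp_all add: path_word_simps Cons)
  qed
  then show "count_list (path_word (k # ks)) North = length ks"
    "count_list (path_word (k # ks)) East = k + sum_list ks" by auto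
qed

lemma count_path_word_snoc:
  "count_list (path_word (us @ [a])) North = length us"
  "count_list (path_word (us @ [a])) East = sum_list us + a"
  by (cases us; simp add: count_path_word)+

text \<open>The altitude gained along a factor \<open>w\<close>, where \<open>G y\<close> is the sum of the increments of its first \<open>y\<close> north
steps.\<close>
definition word_height :: "(nat \<Rightarrow> nat) \<Rightarrow> step list \<Rightarrow> int" where
  "word_height G w = int (G (count_list w North)) - int (count_list w East)"

text \<open>The word of an excursion starts with a north step and descends in steps of 1, so it cannot jump over its
starting altitude: until it returns there it stays strictly above. It is enough to check this at
the ends of the runs of east steps, the lowest points.\<close>
lemma excursion_runs_iff:
  fixes bs :: "nat list" and b :: nat
  assumes G: "G 0 = 0" "mono G"
  defines "B \<equiv> North # path_word (bs @ [b])"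
  shows "word_height G B = 0 \<and> (\<forall>u. 0 < u \<and> u < length B \<longrightarrow> word_height G (take u B) \<noteq> 0) \<longleftrightarrow>
    (\<forall>t. 0 < t \<and> t \<le> length bs \<longrightarrow> sum_list (take t bs) < G t) \<and> sum_list bs + b = G (Suc (length bs))"
    (is "?l \<longleftrightarrow> ?r")
proof
  assume l: ?l
  have pos: "0 < word_height G (take u B)" if "0 < u" "u < length B" for u
    using that
  proof (induction u)
    case (Suc u)
    have "take (Suc u) B = take u B @ [B ! u]" using Suc.prems(2) by (intro take_Suc_conv_app_nth) simp
    moreover have "G (count_list (take u B) North) \<le> G (Suc (count_list (take u B) North))"
      by (rule monoD[OF G(2)]) simp
    ultimately have "word_height G (take u B) - 1 \<le> word_height G (take (Suc u) B)"
      by (cases "B ! u") (simp_all add: word_height_def)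
    moreover have "word_height G (take (Suc u) B) \<noteq> 0" using l Suc.prems by blast
    moreover have "0 \<le> word_height G (take (Suc 0) B)" by (simp add: word_height_def B_def)
    ultimately show ?case using Suc by (cases "u = 0") auto
  qed simp
  have "sum_list (take t bs) < G t" if t: "0 < t" "t \<le> length bs" for t
  proof -
    obtain us a where us: "take t bs = us @ [a]" using t by (metis rev_exhaust take_eq_Nil less_irrefl list.size(3) not_less)
    have "bs @ [b] = us @ (a + 0) # (drop t bs @ [b])"
      using append_take_drop_id[of t bs] us by (metis append.assoc append_Cons append_Nil add_0_right)
    then have sp: "path_word (bs @ [b]) = path_word (us @ [a]) @ path_word (0 # drop t bs @ [b])"
      by (simp only: path_word_append)
    have "path_word (0 # drop t bs @ [b]) \<noteq> []" by (cases "drop t bs") (simp_all add: path_word_simps)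
    then have len: "Suc (length (path_word (us @ [a]))) < length B" by (simp add: B_def sp)
    have "take (Suc (length (path_word (us @ [a])))) B = North # path_word (us @ [a])" by (simp add: B_def sp)
    then have "0 < word_height G (North # path_word (us @ [a]))" using pos[OF _ len] by simp
    moreover have "length us + 1 = t" using us t by (metis length_append_singleton length_take min.absorb2 Suc_eq_plus1)
    ultimately show ?thesis unfolding us by (auto simp: word_height_def count_path_word_snoc)
  qed
  moreover have "sum_list bs + b = G (Suc (length bs))"
    using l by (simp add: word_height_def B_def count_path_word_snoc)
  ultimately show ?r by blast
next
  assume r: ?r
  have "word_height G (take u B) \<noteq> 0" if u: "0 < u" "u < length B" for u
  proof -
    obtain u' where u': "u = Suc u'" using u(1) by (cases u) auto
    let ?W = "path_word (bs @ [b])"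
    obtain us x where us: "take u' ?W = path_word (us @ [x])" by (rule path_word_snocE)
    obtain y vs where vs: "drop u' ?W = path_word (y # vs)" by (rule path_word_ConsE)
    have "?W = path_word (us @ (x + y) # vs)"
      using append_take_drop_id[of u' ?W] unfolding us vs by (simp add: path_word_append)
    then have eq: "bs @ [b] = us @ (x + y) # vs" by (rule path_word_inj) auto
    have ne: "path_word (y # vs) \<noteq> []" using u u' vs[symmetric] by (simp add: B_def)
    have "sum_list us + x < G (Suc (length us))"
    proof (cases vs rule: rev_cases)
      case Nil
      then have "bs = us" "b = x + y" using eq by auto
      moreover have "y \<noteq> 0" using ne Nil by (cases y) (simp_all add: path_word_simps)
      ultimately show ?thesis using r by simp
    next
      case (snoc vs' b')
      then have "bs = us @ (x + y) # vs'" using eq by simp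
      then show ?thesis using r[THEN conjunct1, rule_format, of "Suc (length us)"] by simp
    qed
    then show ?thesis using u' us by (simp add: B_def word_height_def count_path_word_snoc)
  qed
  moreover have "word_height G B = 0" using r by (simp add: word_height_def B_def count_path_word_snoc)
  ultimately show ?l by blast
qed

definition partial_incr :: "nat list \<Rightarrow> nat \<Rightarrow> nat \<Rightarrow> nat" where
  "partial_incr \<delta> j t = (\<Sum>i<t. \<delta> ! (j + i))"

lemma altitude_append:
  "altitude \<delta> (A @ U @ C) (length (A @ U)) =
     altitude \<delta> (A @ U @ C) (length A) + word_height (partial_incr \<delta> (count_list A North)) U"
proof -
  have "(\<Sum>i<x + y. \<delta> ! i) = (\<Sum>i<x. \<delta> ! i) + (\<Sum>i<y. \<delta> ! (x + i))" for x y
    by (induction y) auto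
  then show ?thesis by (simp add: altitude_def word_height_def partial_incr_def)
qed

text \<open>The word \<open>North # path_word (bs @ [b])\<close>, whose first step is north step \<open>j\<close>, is an excursion that returns
for the first time at its end.\<close>
definition excursion_runs :: "nat list \<Rightarrow> nat \<Rightarrow> nat list \<Rightarrow> nat \<Rightarrow> bool" where
  "excursion_runs \<delta> j bs b \<longleftrightarrow> (\<forall>t. 0 < t \<and> t \<le> length bs \<longrightarrow> sum_list (take t bs) < partial_incr \<delta> j t) \<and>
     sum_list bs + b = partial_incr \<delta> j (Suc (length bs))"

lemma rotation_condition:
  assumes w: "w = path_word (us @ [a]) @ [East] @ (North # path_word (bs @ [b])) @ C"
  defines "p \<equiv> length (path_word (us @ [a]) @ [East])"
    and "q \<equiv> length (path_word (us @ [a]) @ [East] @ (North # path_word (bs @ [b])))"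
  shows "altitude \<delta> w q = altitude \<delta> w p \<and> (\<forall>k. p < k \<and> k < q \<longrightarrow> altitude \<delta> w k \<noteq> altitude \<delta> w p) \<longleftrightarrow>
     excursion_runs \<delta> (length us) bs b"
proof -
  let ?B = "North # path_word (bs @ [b])" and ?A = "path_word (us @ [a]) @ [East]"
  let ?G = "partial_incr \<delta> (length us)"
  have alt: "altitude \<delta> w (p + u) = altitude \<delta> w p + word_height ?G (take u ?B)" if "u \<le> length ?B" for u
  proof -
    have "w = ?A @ take u ?B @ drop u ?B @ C" using w append_take_drop_id[of u ?B] by (metis append.assoc)
    moreover have "p + u = length (?A @ take u ?B)" using that by (simp add: p_def)
    moreover have "count_list ?A North = length us" by (simp add: count_path_word_snoc)
    ultimately show ?thesis using altitude_append[of \<delta> ?A "take u ?B" "drop u ?B @ C"] unfolding p_def by simp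
  qed
  have q: "q = p + length ?B" by (simp add: p_def q_def)
  have "altitude \<delta> w q = altitude \<delta> w p \<longleftrightarrow> word_height ?G ?B = 0" using alt[of "length ?B"] q by simp
  moreover have "(\<forall>k. p < k \<and> k < q \<longrightarrow> altitude \<delta> w k \<noteq> altitude \<delta> w p) \<longleftrightarrow>
     (\<forall>u. 0 < u \<and> u < length ?B \<longrightarrow> word_height ?G (take u ?B) \<noteq> 0)" (is "?l \<longleftrightarrow> ?r")
  proof
    assume ?l
    then have "altitude \<delta> w (p + u) \<noteq> altitude \<delta> w p" if "0 < u" "u < length ?B" for u using that q by simp
    then show ?r using alt by force
  next
    assume r: ?r
    show ?l
    proof (intro allI impI)
      fix k assume "p < k \<and> k < q"
      then have "k = p + (k - p)" "0 < k - p" "k - p < length ?B" using q by auto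
      then show "altitude \<delta> w k \<noteq> altitude \<delta> w p" using r alt[of "k - p"] by (metis add_cancel_left_right less_imp_le)
    qed
  qed
  moreover have "mono ?G" by (auto simp: partial_incr_def mono_iff_le_Suc)
  ultimately show ?thesis
    using excursion_runs_iff[of ?G bs b] by (simp add: excursion_runs_def partial_incr_def)
qed

text \<open>In terms of run lengths a rotation moves one unit from the run before the valley to the run in which
the excursion ends; that run splits as \<open>b + c\<close> at the point \<open>q\<close>.\<close>
lemma rotation_runs_iff:
  assumes "\<mu> \<noteq> []" "\<mu>' \<noteq> []"
  shows "rotation \<delta> \<mu> \<mu>' \<longleftrightarrow> (\<exists>us a bs b c cs. \<mu> = us @ [Suc a] @ bs @ [b + c] @ cs \<and>
     \<mu>' = us @ [a] @ bs @ [Suc (b + c)] @ cs \<and> excursion_runs \<delta> (length us) bs b)" (is "_ \<longleftrightarrow> ?r")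
proof -
  have w: "path_word (us @ [Suc a] @ bs @ [b + c] @ cs) =
      path_word (us @ [a]) @ [East] @ (North # path_word (bs @ [b])) @ path_word (c # cs)"
    and w': "path_word (us @ [a] @ bs @ [Suc (b + c)] @ cs) =
      path_word (us @ [a]) @ (North # path_word (bs @ [b])) @ [East] @ path_word (c # cs)" for us a bs b c cs
  proof -
    have e: "x @ [y] @ z = x @ y # z" for x y and z :: "nat list" by simp
    have n: "North # path_word (bs @ z # cs) = path_word (0 # bs @ z # cs)" for z
      by (cases bs) (simp_all add: path_word_simps)
    have "path_word (us @ [a]) @ [East] @ (North # path_word (bs @ [b])) @ path_word (c # cs) =
      path_word (us @ [a]) @ East # North # path_word (bs @ (b + c) # cs)" by (simp add: path_word_append)
    also have "\<dots> = path_word (us @ [a]) @ path_word (Suc 0 # bs @ (b + c) # cs)"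
      by (simp add: n path_word_simps)
    also have "\<dots> = path_word (us @ (a + Suc 0) # bs @ (b + c) # cs)" by (rule path_word_append)
    finally show "path_word (us @ [Suc a] @ bs @ [b + c] @ cs) =
      path_word (us @ [a]) @ [East] @ (North # path_word (bs @ [b])) @ path_word (c # cs)" by simp
    have "path_word (us @ [a]) @ (North # path_word (bs @ [b])) @ [East] @ path_word (c # cs) =
       path_word (us @ [a]) @ North # path_word (bs @ [b]) @ path_word (Suc c # cs)" by (simp add: path_word_simps)
    also have "\<dots> = path_word (us @ [a]) @ path_word (0 # bs @ (b + Suc c) # cs)" by (simp add: path_word_append n)
    also have "\<dots> = path_word (us @ (a + 0) # bs @ (b + Suc c) # cs)" by (rule path_word_append)
    finally show "path_word (us @ [a] @ bs @ [Suc (b + c)] @ cs) =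
      path_word (us @ [a]) @ (North # path_word (bs @ [b])) @ [East] @ path_word (c # cs)" by simp
  qed
  show ?thesis
  proof
    assume "rotation \<delta> \<mu> \<mu>'"
    then obtain A B C where d: "path_word \<mu> = A @ [East] @ B @ C" "path_word \<mu>' = A @ B @ [East] @ C"
      "B \<noteq> []" "hd B = North"
      "altitude \<delta> (path_word \<mu>) (length (A @ [East] @ B)) = altitude \<delta> (path_word \<mu>) (length (A @ [East])) \<and>
       (\<forall>k. length (A @ [East]) < k \<and> k < length (A @ [East] @ B) \<longrightarrow>
          altitude \<delta> (path_word \<mu>) k \<noteq> altitude \<delta> (path_word \<mu>) (length (A @ [East])))"
      unfolding rotation_def by blast
    obtain us a where A: "A = path_word (us @ [a])" by (rule path_word_snocE)
    obtain bs b where "tl B = path_word (bs @ [b])" by (rule path_word_snocE)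
    then have B: "B = North # path_word (bs @ [b])" using d(3,4) by (cases B) auto
    obtain c cs where C: "C = path_word (c # cs)" by (rule path_word_ConsE)
    have "\<mu> = us @ [Suc a] @ bs @ [b + c] @ cs"
      by (rule path_word_inj) (use d(1) assms w A B C in auto)
    moreover have "\<mu>' = us @ [a] @ bs @ [Suc (b + c)] @ cs"
      by (rule path_word_inj) (use d(2) assms w' A B C in auto)
    moreover have "excursion_runs \<delta> (length us) bs b"
      using d(5) rotation_condition[OF d(1)[unfolded A B], of \<delta>] unfolding A B by blast
    ultimately show ?r by blast
  next
    assume ?r
    then obtain us a bs b c cs where r: "\<mu> = us @ [Suc a] @ bs @ [b + c] @ cs"
     "\<mu>' = us @ [a] @ bs @ [Suc (b + c)] @ cs" "excursion_runs \<delta> (length us) bs b" by blast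
    show "rotation \<delta> \<mu> \<mu>'" unfolding rotation_def
      using w[of us a bs b c cs] w'[of us a bs b c cs] r
        rotation_condition[OF w[of us a bs b c cs], of \<delta>]
      by (intro exI[of _ "path_word (us @ [a])"] exI[of _ "North # path_word (bs @ [b])"]
          exI[of _ "path_word (c # cs)"] exI) auto
  qed
qed

section \<open>Paths as integer sequences\<close>

text \<open>The number of east steps before north step \<open>t\<close>, extended beyond the last north step by the total
number of east steps.\<close>
definition east_before :: "nat list \<Rightarrow> nat \<Rightarrow> int" where
  "east_before \<mu> t = int (sum_list (take (Suc t) \<mu>))"

lemma east_before_0: "\<mu> \<noteq> [] \<Longrightarrow> east_before \<mu> 0 = int (\<mu> ! 0)"
  by (cases \<mu>) (auto simp: east_before_def)

lemma east_before_Suc: "Suc t < length \<mu> \<Longrightarrow> east_before \<mu> (Suc t) = east_before \<mu> t + int (\<mu> ! Suc t)"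
  by (simp add: east_before_def take_Suc_conv_app_nth[of "Suc t"])

lemma east_before_end: "length \<mu> \<le> Suc t \<Longrightarrow> east_before \<mu> t = int (sum_list \<mu>)"
  by (simp add: east_before_def)

lemma mono_east_before: "mono (east_before \<mu>)"
proof -
  have "east_before \<mu> t \<le> east_before \<mu> (Suc t)" for t
    by (cases "Suc t < length \<mu>") (simp_all add: east_before_Suc east_before_end)
  then show ?thesis by (simp add: mono_iff_le_Suc)
qed

lemma sum_nth_eq_east_before: "t < length \<mu> \<Longrightarrow> int (\<Sum>i\<le>t. \<mu> ! i) = east_before \<mu> t"
proof (induction t)
  case 0
  then show ?case by (cases \<mu>) (auto simp: east_before_def)
qed (simp add: east_before_Suc)

lemma east_before_inj:
  assumes "length \<mu> = length \<mu>'" "east_before \<mu> = east_before \<mu>'"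
  shows "\<mu> = \<mu>'"
proof (rule nth_equalityI[OF assms(1)])
  fix t assume t: "t < length \<mu>"
  show "\<mu> ! t = \<mu>' ! t"
  proof (cases t)
    case 0
    then show ?thesis using t assms east_before_0[of \<mu>] east_before_0[of \<mu>'] by (cases "\<mu> = []") auto
  next
    case (Suc u)
    then show ?thesis using t assms east_before_Suc[of u \<mu>] east_before_Suc[of u \<mu>'] by auto
  qed
qed

lemma ex_list_east_before:
  assumes "mono f" "0 \<le> f 0"
  obtains \<mu> where "length \<mu> = Suc n" "\<And>t. t \<le> n \<Longrightarrow> east_before \<mu> t = f t"
proof -
  define \<mu> where "\<mu> = map (\<lambda>t. nat (f t - (if t = 0 then 0 else f (t - 1)))) [0..<Suc n]"
  have l: "length \<mu> = Suc n" by (simp add: \<mu>_def)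
  have nth: "\<mu> ! t = nat (f t - (if t = 0 then 0 else f (t - 1)))" if "t \<le> n" for t
    using that by (simp add: \<mu>_def del: upt_Suc)
  have "east_before \<mu> t = f t" if "t \<le> n" for t
    using that
  proof (induction t)
    case 0
    have "\<mu> \<noteq> []" using l by auto
    then show ?case using nth[of 0] assms(2) by (simp add: east_before_0)
  next
    case (Suc t)
    have "f t \<le> f (Suc t)" using assms(1) by (simp add: monoD)
    then show ?case using Suc l nth[of "Suc t"] by (simp add: east_before_Suc)
  qed
  then show ?thesis using that l by blast
qed

text \<open>Moving one unit between runs lowers the partial sums between them.\<close>
lemma east_before_move:
  "east_before (us @ [a] @ bs @ [Suc d] @ cs) =
     lower (east_before (us @ [Suc a] @ bs @ [d] @ cs)) {length us..length us + length bs} 1"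
proof
  fix t
  let ?goal = "east_before (us @ [a] @ bs @ [Suc d] @ cs) t =
     lower (east_before (us @ [Suc a] @ bs @ [d] @ cs)) {length us..length us + length bs} 1 t"
  consider "t < length us" | "length us \<le> t" "t \<le> length us + length bs" | "length us + length bs < t"
    by linarith
  then show ?goal
  proof cases
    case 1
    then show ?thesis by (simp add: east_before_def lower_def)
  next
    case 2
    then obtain u where "t = length us + u" using le_Suc_ex by blast
    then show ?thesis using 2 by (simp add: east_before_def lower_def)
  next
    case 3
    then obtain u where "t = Suc (length us + length bs + u)" using less_imp_Suc_add by blast
    then show ?thesis by (simp add: east_before_def lower_def)
  qed
qed

lemma excursion_eq_atLeastAtMost:
  assumes "j \<le> e" "\<And>t. j < t \<Longrightarrow> t \<le> e \<Longrightarrow> a j < a t" "a (Suc e) \<le> a j"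
  shows "excursion a j = {j..e}"
proof (intro equalityI subsetI)
  fix k assume k: "k \<in> excursion a j"
  have "k \<le> e"
  proof (rule ccontr)
    assume "\<not> k \<le> e"
    then have "a j < a (Suc e)" using k assms(1) by (auto simp: excursion_def)
    then show False using assms(3) by simp
  qed
  then show "k \<in> {j..e}" using k by (auto simp: excursion_def)
qed (use assms(2) in \<open>auto simp: excursion_def\<close>)

section \<open>The alt nu-Tamari order as the order on sequences\<close>
locale word_tamari =
  fixes \<nu> \<delta> :: "nat list"
  assumes incr: "increment_vector \<nu> \<delta>"
begin

lemma len: "length \<nu> = Suc (length \<delta>)"
  using incr by (simp add: increment_vector_def)

definition delta_sum :: "nat \<Rightarrow> int" where "delta_sum t = int (sum_list (take t \<delta>))"

lemma delta_sum_Suc: "t < length \<delta> \<Longrightarrow> delta_sum (Suc t) = delta_sum t + int (\<delta> ! t)"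
  by (simp add: delta_sum_def take_Suc_conv_app_nth)

sublocale nu_alt "length \<delta>" "east_before \<nu>" delta_sum
proof
  have "delta_sum t \<le> delta_sum (Suc t) \<and> east_before \<nu> t - delta_sum t \<le> east_before \<nu> (Suc t) - delta_sum (Suc t)" for t
  proof (cases "t < length \<delta>")
    case True
    then have "\<delta> ! t \<le> \<nu> ! Suc t" using incr by (simp add: increment_vector_def)
    then show ?thesis using True len by (simp add: delta_sum_Suc east_before_Suc)
  next
    case False
    then show ?thesis using len by (simp add: delta_sum_def east_before_def)
  qed
  then show "mono delta_sum" "mono (\<lambda>t. east_before \<nu> t - delta_sum t)" by (simp_all add: mono_iff_le_Suc)
qed

lemma nu_paths_iff: "\<mu> \<in> nu_paths \<nu> \<longleftrightarrow> length \<mu> = Suc (length \<delta>) \<and> east_before \<mu> \<in> paths"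
proof (cases "length \<mu> = Suc (length \<delta>)")
  case True
  have a: "(\<Sum>i\<le>t. \<mu> ! i) \<le> (\<Sum>i\<le>t. \<nu> ! i) \<longleftrightarrow> east_before \<mu> t \<le> east_before \<nu> t" if "t < length \<nu>" for t
    using sum_nth_eq_east_before[of t \<mu>] sum_nth_eq_east_before[of t \<nu>] that True len
    by (metis of_nat_le_iff)
  have b: "sum_list \<mu> = sum_list \<nu> \<longleftrightarrow> (\<forall>t\<ge>length \<delta>. east_before \<mu> t = east_before \<nu> t)"
    using True len by (auto simp: east_before_end)
  have "(\<forall>t<length \<nu>. east_before \<mu> t \<le> east_before \<nu> t) \<and> sum_list \<mu> = sum_list \<nu> \<longleftrightarrow>
    (\<forall>t. east_before \<mu> t \<le> east_before \<nu> t) \<and> (\<forall>t\<ge>length \<delta>. east_before \<mu> t = east_before \<nu> t)"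
    unfolding b using len by (metis less_Suc_eq_le linorder_not_less order_refl nat_le_linear)
  then show ?thesis using True len a mono_east_before[of \<mu>]
    by (auto simp: nu_paths_def paths_def east_before_def)
qed (simp add: nu_paths_def len)

lemma bij_nu_paths: "bij_betw east_before (nu_paths \<nu>) paths"
proof (rule bij_betw_imageI)
  show "inj_on east_before (nu_paths \<nu>)"
    by (rule inj_onI) (auto simp: nu_paths_iff intro: east_before_inj)
  show "east_before ` nu_paths \<nu> = paths"
  proof (intro equalityI subsetI)
    fix f assume f: "f \<in> paths"
    then obtain \<mu> where \<mu>: "length \<mu> = Suc (length \<delta>)" "\<And>t. t \<le> length \<delta> \<Longrightarrow> east_before \<mu> t = f t"
      using ex_list_east_before[of f] by (auto simp: paths_def)
    have "east_before \<mu> t = f t" for t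
    proof (cases "t \<le> length \<delta>")
      case False
      then have "east_before \<mu> t = east_before \<mu> (length \<delta>)" using \<mu>(1) by (simp add: east_before_end)
      also have "\<dots> = f (length \<delta>)" using \<mu>(2) by simp
      also have "\<dots> = f t" using f False len by (auto simp: paths_def east_before_end)
      finally show ?thesis .
    qed (use \<mu>(2) in simp)
    then have "east_before \<mu> = f" by (rule ext)
    then show "f \<in> east_before ` nu_paths \<nu>" using f \<mu>(1) nu_paths_iff by blast
  qed (auto simp: nu_paths_iff)
qed

lemma delta_sum_diff: "j + t \<le> length \<delta> \<Longrightarrow> delta_sum (j + t) = delta_sum j + int (partial_incr \<delta> j t)"
  by (induction t) (auto simp: partial_incr_def delta_sum_Suc)

lemma alt_runs:
  assumes "\<mu> = us @ [a] @ bs @ [d] @ cs" "length \<mu> = Suc (length \<delta>)"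
  shows "t \<le> length bs \<Longrightarrow> alt (east_before \<mu>) (length us + t) =
      alt (east_before \<mu>) (length us) + int (partial_incr \<delta> (length us) t) - int (sum_list (take t bs))"
    and "alt (east_before \<mu>) (Suc (length us + length bs)) =
      alt (east_before \<mu>) (length us) + int (partial_incr \<delta> (length us) (Suc (length bs))) - int (sum_list bs + d)"
  using delta_sum_diff[of "length us" t] delta_sum_diff[of "length us" "Suc (length bs)"] assms
  by (auto simp: alt_def east_before_def)

lemma rotation_rotate:
  assumes \<mu>: "\<mu> = us @ [Suc a] @ bs @ [b + c] @ cs" "length \<mu> = Suc (length \<delta>)"
    and e: "excursion_runs \<delta> (length us) bs b"
  shows "length us < length \<delta>" "slack (east_before \<mu>) (length us) 1"
    "east_before (us @ [a] @ bs @ [Suc (b + c)] @ cs) = rotate (length us) (east_before \<mu>)"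
proof -
  show "length us < length \<delta>" using \<mu> by simp
  have "block (east_before \<mu>) (length us) = {length us..length us + length bs}"
  proof (rule excursion_eq_atLeastAtMost)
    fix t assume "length us < t" "t \<le> length us + length bs"
    then have "t = length us + (t - length us)" "0 < t - length us" "t - length us \<le> length bs" by auto
    then show "alt (east_before \<mu>) (length us) < alt (east_before \<mu>) t"
      using alt_runs(1)[OF \<mu>, of "t - length us"] e by (auto simp: excursion_runs_def)
  qed (use alt_runs(2)[OF \<mu>] e in \<open>auto simp: excursion_runs_def\<close>)
  then show "east_before (us @ [a] @ bs @ [Suc (b + c)] @ cs) = rotate (length us) (east_before \<mu>)"
    unfolding rotate_def \<mu>(1) east_before_move by simp
  have "east_before \<mu> i + 1 \<le> east_before \<mu> (length us)" if "i < length us" for i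
  proof -
    have "sum_list (take (Suc i) us) \<le> sum_list us"
      using append_take_drop_id[of "Suc i" us] by (metis sum_list_append le_add1)
    then show ?thesis using that \<mu>(1) by (simp add: east_before_def)
  qed
  then show "slack (east_before \<mu>) (length us) 1" using \<mu>(1) by (auto simp: slack_def east_before_def)
qed

text \<open>For the converse direction, the excursion of \<open>j\<close> is an interval \<open>{j..j + m}\<close>; the run after north step
\<open>j + m\<close> is the one that contains the return point, and \<open>b\<close> is the part of it needed to get back to
the starting altitude.\<close>
lemma rotation_iff_rotate:
  assumes \<mu>: "\<mu> \<in> nu_paths \<nu>" and \<mu>': "\<mu>' \<in> nu_paths \<nu>"
  shows "rotation \<delta> \<mu> \<mu>' \<longleftrightarrow>
    (\<exists>j<length \<delta>. slack (east_before \<mu>) j 1 \<and> east_before \<mu>' = rotate j (east_before \<mu>))"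
proof -
  have l: "length \<mu> = Suc (length \<delta>)" "length \<mu>' = Suc (length \<delta>)" "east_before \<mu> \<in> paths"
    using \<mu> \<mu>' by (auto simp: nu_paths_iff)
  then have ne: "\<mu> \<noteq> []" "\<mu>' \<noteq> []" by auto
  show ?thesis unfolding rotation_runs_iff[OF ne]
  proof
    assume "\<exists>us a bs b c cs. \<mu> = us @ [Suc a] @ bs @ [b + c] @ cs \<and>
      \<mu>' = us @ [a] @ bs @ [Suc (b + c)] @ cs \<and> excursion_runs \<delta> (length us) bs b"
    then obtain us a bs b c cs where r: "\<mu> = us @ [Suc a] @ bs @ [b + c] @ cs"
      "\<mu>' = us @ [a] @ bs @ [Suc (b + c)] @ cs" "excursion_runs \<delta> (length us) bs b" by blast
    then show "\<exists>j<length \<delta>. slack (east_before \<mu>) j 1 \<and> east_before \<mu>' = rotate j (east_before \<mu>)"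
      using rotation_rotate[OF r(1) l(1) r(3)] unfolding r(2) by blast
  next
    assume "\<exists>j<length \<delta>. slack (east_before \<mu>) j 1 \<and> east_before \<mu>' = rotate j (east_before \<mu>)"
    then obtain j where j: "j < length \<delta>" "slack (east_before \<mu>) j 1" "east_before \<mu>' = rotate j (east_before \<mu>)"
      by blast
    let ?X = "block (east_before \<mu>) j"
    have "?X \<subseteq> {..<length \<delta>}" using block_less_n[OF l(3) j(1)] by auto
    then have fin: "finite ?X" by (rule finite_subset) simp
    define m where "m = Max ?X - j"
    have M: "j + m \<in> ?X" using Max_in[OF fin] excursion_self[of j] excursion_le by (fastforce simp: m_def)
    then have jm: "j + m < length \<delta>" using block_less_n[OF l(3) j(1)] by blast
    have out: "Suc (j + m) \<notin> ?X"
      using Max_ge[OF fin, of "Suc (j + m)"] excursion_le[of "Max ?X"] Max_in[OF fin] excursion_self[of j] by (force simp: m_def)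
    have up: "alt (east_before \<mu>) j < alt (east_before \<mu>) t" if "j < t" "t \<le> j + m" for t
      using M that by (simp add: excursion_def)
    have dn: "alt (east_before \<mu>) (Suc (j + m)) \<le> alt (east_before \<mu>) j"
      using out up by (force simp: excursion_def le_Suc_eq)
    define us where "us = take j \<mu>"
    define bs where "bs = take m (drop (Suc j) \<mu>)"
    define d where "d = \<mu> ! (Suc (j + m))"
    define cs where "cs = drop (Suc (Suc (j + m))) \<mu>"
    have lus: "length us = j" "length bs = m" using l jm by (auto simp: us_def bs_def)
    have "0 < \<mu> ! j"
    proof (cases j)
      case 0
      then show ?thesis using j(2) ne by (simp add: slack_def east_before_0)
    next
      case (Suc i)
      then have "east_before \<mu> i + 1 \<le> east_before \<mu> (Suc i)" using j(2) by (simp add: slack_def)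
      then show ?thesis using Suc j(1) l(1) by (simp add: east_before_Suc)
    qed
    then obtain a where a: "\<mu> ! j = Suc a" by (cases "\<mu> ! j") auto
    have "\<mu> = us @ \<mu> ! j # drop (Suc j) \<mu>" using id_take_nth_drop[of j \<mu>] j(1) l(1) by (simp add: us_def)
    moreover have "drop (Suc j) \<mu> = bs @ d # cs"
      using id_take_nth_drop[of m "drop (Suc j) \<mu>"] jm l(1) by (simp add: bs_def d_def cs_def add.commute)
    ultimately have dec: "\<mu> = us @ [Suc a] @ bs @ [d] @ cs" using a by simp
    have lt: "sum_list (take t bs) < partial_incr \<delta> j t" if "0 < t" "t \<le> m" for t
      using up[of "j + t"] alt_runs(1)[OF dec l(1), of t] that lus by simp
    have le: "partial_incr \<delta> j (Suc m) \<le> sum_list bs + d"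
      using dn alt_runs(2)[OF dec l(1)] lus by simp
    \<comment> \<open>The subtraction does not truncate, by the strict inequality at the end of \<open>bs\<close>.\<close>
    define b where "b = partial_incr \<delta> j (Suc m) - sum_list bs"
    have "sum_list bs \<le> partial_incr \<delta> j m" using lt[of m] lus by (cases "m = 0") auto
    then have b: "sum_list bs + b = partial_incr \<delta> j (Suc m)" by (simp add: b_def partial_incr_def)
    then obtain c where c: "d = b + c" using le by (metis add_le_cancel_left le_Suc_ex)
    have e: "excursion_runs \<delta> (length us) bs b" using lt b lus by (simp add: excursion_runs_def)
    have "east_before (us @ [a] @ bs @ [Suc (b + c)] @ cs) = east_before \<mu>'"
      using rotation_rotate(3)[OF dec[unfolded c] l(1) e] j(3) lus by simp
    moreover have "length (us @ [a] @ bs @ [Suc (b + c)] @ cs) = length \<mu>'"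
      using l unfolding dec by simp
    ultimately have "\<mu>' = us @ [a] @ bs @ [Suc (b + c)] @ cs" using east_before_inj by metis
    then show "\<exists>us a bs b c cs. \<mu> = us @ [Suc a] @ bs @ [b + c] @ cs \<and>
      \<mu>' = us @ [a] @ bs @ [Suc (b + c)] @ cs \<and> excursion_runs \<delta> (length us) bs b"
      using dec e c by blast
  qed
qed

lemma rotation_rel_iff:
  assumes "\<mu> \<in> nu_paths \<nu>" "\<mu>' \<in> nu_paths \<nu>"
  shows "(\<mu>, \<mu>') \<in> rotation_rel \<nu> \<delta> \<longleftrightarrow> (east_before \<mu>, east_before \<mu>') \<in> rotations"
  using assms rotation_iff_rotate[OF assms] by (auto simp: rotation_rel_def rotations_def nu_paths_iff)

lemma alt_tamari_iff:
  assumes "\<mu> \<in> nu_paths \<nu>" "\<mu>' \<in> nu_paths \<nu>"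
  shows "(\<mu>, \<mu>') \<in> alt_tamari \<nu> \<delta> \<longleftrightarrow> (east_before \<mu>, east_before \<mu>') \<in> tam"
proof -
  have "(east_before \<mu>, east_before \<mu>') \<in> rotations\<^sup>*" if "(\<mu>, \<mu>') \<in> (rotation_rel \<nu> \<delta>)\<^sup>*"
    using that
  proof (induction rule: rtrancl_induct)
    case (step x y)
    then have "(east_before x, east_before y) \<in> rotations"
      using rotation_rel_iff[of x y] by (simp add: rotation_rel_def)
    then show ?case using step.IH by simp
  qed simp
  moreover have "\<forall>x\<in>nu_paths \<nu>. east_before x = f \<longrightarrow> (\<mu>, x) \<in> (rotation_rel \<nu> \<delta>)\<^sup>*"
    if "(east_before \<mu>, f) \<in> rotations\<^sup>*" for f
    using that
  proof (induction rule: rtrancl_induct)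
    case base
    have "x = \<mu>" if "x \<in> nu_paths \<nu>" "east_before x = east_before \<mu>" for x
      using that assms(1) east_before_inj by (simp add: nu_paths_iff)
    then show ?case by blast
  next
    case (step f g)
    show ?case
    proof (intro ballI impI)
      fix x assume x: "x \<in> nu_paths \<nu>" "east_before x = g"
      have "f \<in> east_before ` nu_paths \<nu>"
        using step.hyps(2) bij_betw_imp_surj_on[OF bij_nu_paths] by (simp add: rotations_def)
      then obtain y where y: "y \<in> nu_paths \<nu>" "east_before y = f" by auto
      then have "(y, x) \<in> rotation_rel \<nu> \<delta>" using rotation_rel_iff[OF y(1) x(1)] step.hyps(2) x(2) by simp
      moreover have "(\<mu>, y) \<in> (rotation_rel \<nu> \<delta>)\<^sup>*" using step.IH y by blast
      ultimately show "(\<mu>, x) \<in> (rotation_rel \<nu> \<delta>)\<^sup>*" by (rule_tac rtrancl_into_rtrancl)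
    qed
  qed
  ultimately show ?thesis using assms by (auto simp: alt_tamari_def tam_def nu_paths_iff)
qed

lemma card_linear_intervals_alt_tamari:
  "card (linear_intervals (alt_tamari \<nu> \<delta>) l) = card {(f, h). linear_interval l f h}"
  unfolding linear_intervals_tam[symmetric]
proof (rule card_linear_intervals_transport[OF bij_nu_paths])
  show "trans tam" by (rule transI) (auto simp: tam_iff intro: tam_le_trans)
  show "antisym tam" by (rule antisymI) (auto simp: tam_iff intro: tam_le_antisym)
qed (auto simp: alt_tamari_iff, auto simp: alt_tamari_def tam_iff tam_le_refl)

lemma finite_paths: "finite paths"
  using bij_nu_paths finite_nu_paths bij_betw_finite by blast

end

theorem theorem6p1:
  fixes \<nu> \<delta> \<delta>' :: "nat list" and l :: nat
  assumes "\<nu> \<noteq> []"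
    and "increment_vector \<nu> \<delta>"
    and "increment_vector \<nu> \<delta>'"
  shows "card (linear_intervals (alt_tamari \<nu> \<delta>) l)
       = card (linear_intervals (alt_tamari \<nu> \<delta>') l)"
proof -
  interpret A: word_tamari \<nu> \<delta> by unfold_locales (rule assms(2))
  interpret B: word_tamari \<nu> \<delta>' by unfold_locales (rule assms(3))
  have n: "length \<delta> = length \<delta>'" using A.len B.len by simp
  have p: "A.paths = B.paths" by (simp add: A.paths_def B.paths_def n)
  have r: "A.return_chains 0 m = B.return_chains 0 m" for m unfolding A.return_chains_def B.return_chains_def p by (simp add: n)
  consider "l = 0" | "l = Suc 0" | k where "l = Suc (Suc k)" by (metis not0_implies_Suc)
  then have "card {(f, h). A.linear_interval l f h} = card {(f, h). B.linear_interval l f h}"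
  proof cases
    case 1
    then show ?thesis by (simp add: A.card_linear_interval_0 B.card_linear_interval_0 p)
  next
    case 2
    then show ?thesis using A.card_linear_interval_1 B.card_linear_interval_1 by (simp add: n p)
  next
    case 3
    show ?thesis
      unfolding 3 A.card_linear_interval_Suc_Suc[OF A.finite_paths] B.card_linear_interval_Suc_Suc[OF B.finite_paths] p r
      by (simp only: n)
  qed
  then show ?thesis by (simp only: A.card_linear_intervals_alt_tamari B.card_linear_intervals_alt_tamari)
qed

end
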